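(* Let $\gamma\in\mathrm{SL}_2(\mathbb{Z})$ and $k\ge1$. If $\operatorname{tr}(\gamma)\neq\pm2$ and $\gamma^k\neq\mathrm{Id}_2$, then \[ c_k(\gamma)=\frac1k\sum_{d\mid k}\phi\!\left(\frac kd\right)\bigl|\operatorname{tr}(\gamma^d)-2\bigr|, \] where $\phi$ is Euler's totient function. Otherwise, \[ c_k(\gamma)=\begin{cases} 1,&\text{if }\gamma^k=\mathrm{Id}_2,\\ |m|k,&\text{if }\gamma\text{ is conjugate in }\mathrm{SL}_2(\mathbb{Z})\text{ to }T^m,\ m\neq0,\\ |m|\tfrac k2+1,&\text{if }\gamma\text{ is conjugate to }-T^m,\ m\neq0,\text{ and }k\text{ is even},\\ 4,&\text{if }\gamma\text{ is conjugate to }-T^m\text{ and }k\text{ is odd}, \end{cases} \] where $T=\begin{pmatrix}1&1\\0&1\end{pmatrix}$.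
   Context: Identify $\mathbb{Z}^{\oplus k}\otimes\mathbb{Z}^{\oplus2}\cong\mathbb{Z}^{2k}$ with coordinates $(j_1,\ell_1,\dots,j_k,\ell_k)$; for $w\in S_k$ and $\gamma\in\mathrm{SL}_2(\mathbb{Z})$, $w\otimes\gamma$ acts by permuting the pairs $(j_i,\ell_i)$ according to $w$ and applying $\gamma$ to each pair. $c_k(\gamma)$ denotes the number of orbits of the cyclic group $\langle(1\,2\cdots k)\rangle\subset S_k$ (acting through its action on $\mathbb{Z}^{2k}$) on the finite set $\operatorname{coker}(\mathrm{Id}_{2k}-(1\,2\cdots k)\otimes\gamma)_{\mathrm{tors}}$, the torsion subgroup of the cokernel. *)

theory Defs
  imports "HOL-Analysis.Analysis" "HOL-Number_Theory.Number_Theory"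
begin

type_synonym imat2 = "int^2^2"

text \<open>Natural-number powers of a 2x2 integer matrix.\<close>
primrec mat_pow :: "imat2 \<Rightarrow> nat \<Rightarrow> imat2" where
  "mat_pow g 0 = mat 1"
| "mat_pow g (Suc n) = g ** mat_pow g n"

definition SL2Z :: "imat2 set" where
  "SL2Z = {g. det g = 1}"

text \<open>T^m = [[1,m],[0,1]] for integer m (T = [[1,1],[0,1]]).\<close>
definition T_pow :: "int \<Rightarrow> imat2" where
  "T_pow m = (\<chi> i j. if i = j then 1 else if i = 1 \<and> j = 2 then m else 0)"

definition conj_SL2Z :: "imat2 \<Rightarrow> imat2 \<Rightarrow> bool" where
  "conj_SL2Z g h \<longleftrightarrow> (\<exists>P Q. P \<in> SL2Z \<and> P ** Q = mat 1 \<and> g = P ** h ** Q)"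

text \<open>Z^n as integer vectors indexed by nat, supported on {0..<n}.
  For Z^{2k}: coordinates (j_i, l_i) = (v (2i), v (2i+1)) for i < k (0-indexed).\<close>
definition zvecs :: "nat \<Rightarrow> (nat \<Rightarrow> int) set" where
  "zvecs n = {v. \<forall>p\<ge>n. v p = 0}"

text \<open>The action of w \<otimes> g on Z^{2k}, where w = (1 2 ... k) is the cyclic
  permutation i \<mapsto> i+1 mod k (0-indexed): pair i is moved to position w(i)
  and g is applied to it (as a column vector).\<close>
definition cyc_tensor :: "nat \<Rightarrow> imat2 \<Rightarrow> (nat \<Rightarrow> int) \<Rightarrow> (nat \<Rightarrow> int)" where
  "cyc_tensor k g v = (\<lambda>p. if p < 2 * k then
      (let i' = (p div 2 + k - 1) mod k; j = v (2 * i'); l = v (2 * i' + 1) in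
        if even p then g $ 1 $ 1 * j + g $ 1 $ 2 * l
        else g $ 2 $ 1 * j + g $ 2 $ 2 * l)
    else 0)"

text \<open>Image lattice of Id - (w \<otimes> g) in Z^{2k}.\<close>
definition img_lattice :: "nat \<Rightarrow> imat2 \<Rightarrow> (nat \<Rightarrow> int) set" where
  "img_lattice k g = (\<lambda>v. v - cyc_tensor k g v) ` zvecs (2 * k)"

text \<open>Class of v in the cokernel Z^{2k} / image.\<close>
definition coker_class :: "nat \<Rightarrow> imat2 \<Rightarrow> (nat \<Rightarrow> int) \<Rightarrow> (nat \<Rightarrow> int) set" where
  "coker_class k g v = {w \<in> zvecs (2 * k). w - v \<in> img_lattice k g}"

text \<open>Torsion subgroup of the cokernel, as a set of classes.\<close>
definition coker_tors :: "nat \<Rightarrow> imat2 \<Rightarrow> (nat \<Rightarrow> int) set set" where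
  "coker_tors k g = {coker_class k g v | v. v \<in> zvecs (2 * k) \<and>
       (\<exists>n::int. n > 0 \<and> (\<lambda>p. n * v p) \<in> img_lattice k g)}"

text \<open>Number of orbits of the cyclic group generated by (1 2 ... k), acting on
  the torsion of the cokernel through its action w \<otimes> Id on Z^{2k}.\<close>
definition c_k :: "nat \<Rightarrow> imat2 \<Rightarrow> nat" where
  "c_k k g = card {{(cyc_tensor k (mat 1) ^^ n) ` C | n. True} | C. C \<in> coker_tors k g}"

end

theory Submission
  imports Defs "HOL-Library.Function_Algebras" "HOL-Algebra.Group_Action"
    "HOL-Algebra.Elementary_Groups"
begin

text \<open>Let \<open>w\<close> be the cyclic shift. The map \<open>v \<mapsto> \<Sum>\<^sub>i \<gamma>\<^sup>k\<^sup>-\<^sup>1\<^sup>-\<^sup>i v\<^sub>i\<close> from \<open>\<int>\<^sup>2\<^sup>k\<close> to \<open>\<int>\<^sup>2\<close>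
  carries the image of \<open>Id - w \<otimes> \<gamma>\<close> onto \<open>(1 - \<gamma>\<^sup>k) \<int>\<^sup>2\<close> and turns \<open>w \<otimes> Id\<close> into \<open>\<gamma>\<^sup>k\<^sup>-\<^sup>1\<close>, so
  \<open>c\<^sub>k(\<gamma>)\<close> is the number of \<open>\<langle>\<gamma>\<^sup>k\<^sup>-\<^sup>1\<rangle>\<close>-orbits on the torsion of \<open>\<int>\<^sup>2 / (1 - \<gamma>\<^sup>k) \<int>\<^sup>2\<close>.
  If \<open>1 - \<gamma>\<^sup>d\<close> is nonsingular for all \<open>d | k\<close>, Burnside's lemma counts them: \<open>\<gamma>\<^sup>(\<^sup>k\<^sup>-\<^sup>1\<^sup>)\<^sup>j\<close>
  fixes the same classes as \<open>\<gamma>\<^sup>g\<^sup>c\<^sup>d\<^sup>(\<^sup>j\<^sup>,\<^sup>k\<^sup>)\<close>, and for \<open>d | k\<close> the classes fixed by \<open>\<gamma>\<^sup>d\<close> form a group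
  of order \<open>|det (1 - \<gamma>\<^sup>d)| = |tr \<gamma>\<^sup>d - 2|\<close>. Nonsingularity fails only if \<open>\<gamma>\<^sup>d = 1\<close>: for
  \<open>|tr \<gamma>| \<ge> 3\<close> the traces \<open>|tr \<gamma>\<^sup>d|\<close> increase, and for \<open>|tr \<gamma>| \<le> 1\<close> we have \<open>\<gamma>\<^sup>1\<^sup>2 = 1\<close>, while an element of
  finite order and trace 2 is the identity. In the
  remaining cases the quotient is explicit: it is free if \<open>\<gamma>\<^sup>k = 1\<close>, and for \<open>\<gamma> \<sim> \<plusminus>T\<^sup>m\<close> its
  torsion is \<open>\<int>/mk\<close>, with \<open>\<gamma>\<^sup>k\<^sup>-\<^sup>1\<close> acting trivially or by \<open>-1\<close>, except for \<open>-T\<^sup>m\<close> with \<open>k\<close> odd,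
  where it is a group of order 4 acted on trivially.\<close>

section \<open>Orbits on the torsion of a quotient group\<close>

definition add_subgroup :: "'a::ab_group_add set \<Rightarrow> bool" where
  "add_subgroup L \<longleftrightarrow> 0 \<in> L \<and> (\<forall>a\<in>L. \<forall>b\<in>L. a - b \<in> L)"

lemma add_subgroup_diff: "add_subgroup L \<Longrightarrow> a \<in> L \<Longrightarrow> b \<in> L \<Longrightarrow> a - b \<in> L"
  by (simp add: add_subgroup_def)

lemma add_subgroup_add: "add_subgroup L \<Longrightarrow> a \<in> L \<Longrightarrow> b \<in> L \<Longrightarrow> a + b \<in> L"
  unfolding add_subgroup_def by (metis diff_0 diff_minus_eq_add)

definition quot_class :: "'a::ab_group_add set \<Rightarrow> 'a set \<Rightarrow> 'a \<Rightarrow> 'a set" where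
  "quot_class V I v = {w \<in> V. w - v \<in> I}"

text \<open>The integer multiplication \<open>zmult\<close> is a parameter because \<open>\<int>\<^sup>2\<^sup>k\<close> is modelled by
  functions on \<open>nat\<close> and \<open>\<int>\<^sup>2\<close> by vectors.\<close>

definition torsion_classes :: "'a::ab_group_add set \<Rightarrow> 'a set \<Rightarrow> (int \<Rightarrow> 'a \<Rightarrow> 'a) \<Rightarrow> 'a set set"
  where "torsion_classes V I zmult =
    {quot_class V I v | v. v \<in> V \<and> (\<exists>n::int. n > 0 \<and> zmult n v \<in> I)}"

definition class_orbit :: "('a \<Rightarrow> 'a) \<Rightarrow> 'a set \<Rightarrow> 'a set set" where
  "class_orbit S C = range (\<lambda>n. (S ^^ n) ` C)"

definition torsion_orbit_count ::
    "'a::ab_group_add set \<Rightarrow> 'a set \<Rightarrow> (int \<Rightarrow> 'a \<Rightarrow> 'a) \<Rightarrow> ('a \<Rightarrow> 'a) \<Rightarrow> nat" where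
  "torsion_orbit_count V I zmult S = card (class_orbit S ` torsion_classes V I zmult)"

definition quotient_action ::
    "'a::ab_group_add set \<Rightarrow> 'a set \<Rightarrow> (int \<Rightarrow> 'a \<Rightarrow> 'a) \<Rightarrow> ('a \<Rightarrow> 'a) \<Rightarrow> bool" where
  "quotient_action V I zmult S \<longleftrightarrow> add_subgroup V \<and> add_subgroup I \<and> I \<subseteq> V \<and>
     (\<forall>n. \<forall>v\<in>V. zmult n v \<in> V) \<and> bij_betw S V V \<and>
     (\<forall>v\<in>V. \<forall>w\<in>V. S (v - w) = S v - S w) \<and> S ` I = I"

lemma quot_class_eq_iff:
  assumes I: "add_subgroup I" and "v \<in> V" "w \<in> V"
  shows "quot_class V I v = quot_class V I w \<longleftrightarrow> v - w \<in> I"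
proof
  assume "quot_class V I v = quot_class V I w"
  moreover have "v \<in> quot_class V I v" using assms by (simp add: quot_class_def add_subgroup_def)
  ultimately show "v - w \<in> I" by (simp add: quot_class_def)
next
  assume vw: "v - w \<in> I"
  have "x - w \<in> I \<longleftrightarrow> x - v \<in> I" for x
    using add_subgroup_add[OF I _ vw, of "x - v"] add_subgroup_diff[OF I _ vw, of "x - w"] by auto
  then show "quot_class V I v = quot_class V I w" unfolding quot_class_def by blast
qed

lemma card_quot_class_image_transversal:
  assumes L: "add_subgroup L" and "R \<subseteq> Y"
    and cover: "\<And>y. y \<in> Y \<Longrightarrow> \<exists>r\<in>R. y - r \<in> L"
    and distinct: "\<And>r r'. r \<in> R \<Longrightarrow> r' \<in> R \<Longrightarrow> r - r' \<in> L \<Longrightarrow> r = r'"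
  shows "card (quot_class UNIV L ` Y) = card R"
proof -
  have "quot_class UNIV L ` Y = quot_class UNIV L ` R"
    using cover \<open>R \<subseteq> Y\<close> quot_class_eq_iff[OF L UNIV_I UNIV_I] by blast
  moreover have "inj_on (quot_class UNIV L) R"
    using distinct quot_class_eq_iff[OF L UNIV_I UNIV_I] by (auto simp: inj_on_def)
  ultimately show ?thesis by (simp add: card_image)
qed

lemma image_funpow_Suc: "(f ^^ Suc n) ` A = f ` (f ^^ n) ` A"
  by (simp add: image_image)

lemma quotient_action_funpow_closed:
  "quotient_action V I zmult S \<Longrightarrow> v \<in> V \<Longrightarrow> (S ^^ n) v \<in> V"
  by (induction n) (auto simp: quotient_action_def bij_betw_def)

lemma quotient_action_image_class:
  assumes q: "quotient_action V I zmult S" and v: "v \<in> V"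
  shows "S ` quot_class V I v = quot_class V I (S v)"
proof -
  have bij: "bij_betw S V V" and hom: "\<And>x. x \<in> V \<Longrightarrow> S (x - v) = S x - S v"
    and SI: "S ` I = I" and IV: "I \<subseteq> V" and V: "add_subgroup V"
    using q v by (auto simp: quotient_action_def)
  show ?thesis
  proof (intro equalityI subsetI)
    fix y assume "y \<in> S ` quot_class V I v"
    then obtain x where x: "x \<in> V" "x - v \<in> I" "y = S x" by (auto simp: quot_class_def)
    then have "S x - S v \<in> I" using hom SI by (metis imageI)
    moreover have "S x \<in> V" using bij_betwE[OF bij] x(1) by blast
    ultimately show "y \<in> quot_class V I (S v)" using x(3) by (simp add: quot_class_def)
  next
    fix y assume "y \<in> quot_class V I (S v)"
    then have y: "y \<in> V" "y - S v \<in> S ` I" using SI by (auto simp: quot_class_def)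
    obtain x where x: "x \<in> V" "y = S x" using y(1) bij_betw_imp_surj_on[OF bij] by blast
    obtain i where i: "i \<in> I" "S i = S (x - v)" using y(2) hom[OF x(1)] x(2) by auto
    have "i = x - v"
      using inj_onD[OF bij_betw_imp_inj_on[OF bij] i(2)] i(1) IV add_subgroup_diff[OF V x(1) v]
      by blast
    then show "y \<in> S ` quot_class V I v" using x i by (auto simp: quot_class_def)
  qed
qed

lemma quotient_action_funpow_image_class:
  assumes q: "quotient_action V I zmult S" and v: "v \<in> V"
  shows "(S ^^ n) ` quot_class V I v = quot_class V I ((S ^^ n) v)"
proof (induction n)
  case (Suc n)
  have "(S ^^ Suc n) ` quot_class V I v = S ` quot_class V I ((S ^^ n) v)"
    using Suc by (simp only: image_funpow_Suc)
  also have "\<dots> = quot_class V I ((S ^^ Suc n) v)"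
    using quotient_action_image_class[OF q quotient_action_funpow_closed[OF q v]] by simp
  finally show ?case .
qed simp

lemma torsion_orbit_count_trivial_action:
  assumes "\<And>C. C \<in> torsion_classes V I zmult \<Longrightarrow> S ` C = C"
  shows "torsion_orbit_count V I zmult S = card (torsion_classes V I zmult)"
proof -
  have "class_orbit S C = {C}" if "C \<in> torsion_classes V I zmult" for C
  proof -
    have "(S ^^ n) ` C = C" for n
      by (induction n) (simp_all only: image_funpow_Suc funpow_0 image_ident assms[OF that])
    then show ?thesis by (auto simp: class_orbit_def)
  qed
  then have "class_orbit S ` torsion_classes V I zmult = (\<lambda>C. {C}) ` torsion_classes V I zmult"
    by auto
  then show ?thesis unfolding torsion_orbit_count_def by (simp add: card_image inj_on_def)
qed

text \<open>\<open>\<Phi>\<close> induces an equivariant isomorphism \<open>V\<^sub>1/I\<^sub>1 \<cong> V\<^sub>2/I\<^sub>2\<close>.\<close>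

locale quotient_action_hom =
  fixes V1 I1 zmult1 S1 and V2 I2 zmult2 S2 and \<Phi> :: "'a::ab_group_add \<Rightarrow> 'b::ab_group_add"
  assumes source: "quotient_action V1 I1 zmult1 S1"
    and target: "quotient_action V2 I2 zmult2 S2"
    and onto: "\<Phi> ` V1 = V2"
    and diff: "\<And>v w. v \<in> V1 \<Longrightarrow> w \<in> V1 \<Longrightarrow> \<Phi> (v - w) = \<Phi> v - \<Phi> w"
    and zmult: "\<And>n v. v \<in> V1 \<Longrightarrow> \<Phi> (zmult1 n v) = zmult2 n (\<Phi> v)"
    and preimage: "\<And>v. v \<in> V1 \<Longrightarrow> v \<in> I1 \<longleftrightarrow> \<Phi> v \<in> I2"
    and equivariant: "\<And>v. v \<in> V1 \<Longrightarrow> \<Phi> (S1 v) - S2 (\<Phi> v) \<in> I2"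
begin

lemma diff_closed: "v \<in> V1 \<Longrightarrow> w \<in> V1 \<Longrightarrow> v - w \<in> V1"
  using source by (simp add: quotient_action_def add_subgroup_def)

lemma image_quot_class:
  assumes v: "v \<in> V1"
  shows "\<Phi> ` quot_class V1 I1 v = quot_class V2 I2 (\<Phi> v)"
proof (intro equalityI subsetI)
  fix y assume "y \<in> \<Phi> ` quot_class V1 I1 v"
  then obtain w where "w \<in> V1" "w - v \<in> I1" "y = \<Phi> w" by (auto simp: quot_class_def)
  then show "y \<in> quot_class V2 I2 (\<Phi> v)"
    using v onto diff preimage diff_closed by (auto simp: quot_class_def)
next
  fix y assume "y \<in> quot_class V2 I2 (\<Phi> v)"
  then obtain w where w: "w \<in> V1" "y = \<Phi> w" "\<Phi> w - \<Phi> v \<in> I2"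
    using onto by (auto simp: quot_class_def)
  then have "w - v \<in> I1" using preimage[of "w - v"] diff diff_closed v by simp
  then show "y \<in> \<Phi> ` quot_class V1 I1 v" using w by (auto simp: quot_class_def)
qed

lemma inj_on_image_classes: "inj_on (image \<Phi>) (quot_class V1 I1 ` V1)"
proof (rule inj_onI)
  fix C D assume "C \<in> quot_class V1 I1 ` V1" "D \<in> quot_class V1 I1 ` V1" and "\<Phi> ` C = \<Phi> ` D"
  then obtain v w where vw: "v \<in> V1" "w \<in> V1" "C = quot_class V1 I1 v" "D = quot_class V1 I1 w"
    and "\<Phi> ` quot_class V1 I1 v = \<Phi> ` quot_class V1 I1 w" by auto
  then have "quot_class V2 I2 (\<Phi> v) = quot_class V2 I2 (\<Phi> w)" by (simp add: image_quot_class)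
  moreover have "add_subgroup I2" using target by (simp add: quotient_action_def)
  ultimately have "\<Phi> v - \<Phi> w \<in> I2"
    using quot_class_eq_iff[of I2 "\<Phi> v" V2 "\<Phi> w"] onto vw by blast
  then have "v - w \<in> I1" using preimage diff diff_closed vw by simp
  moreover have "add_subgroup I1" using source by (simp add: quotient_action_def)
  ultimately show "C = D"
    using quot_class_eq_iff[of I1 v V1 w] vw by blast
qed

lemma funpow_equivariant:
  assumes v: "v \<in> V1"
  shows "\<Phi> ((S1 ^^ n) v) - (S2 ^^ n) (\<Phi> v) \<in> I2"
proof (induction n)
  case 0
  then show ?case using target by (simp add: quotient_action_def add_subgroup_def)
next
  case (Suc n)
  let ?x = "(S1 ^^ n) v" and ?y = "(S2 ^^ n) (\<Phi> v)"
  have x: "?x \<in> V1" using quotient_action_funpow_closed[OF source v] .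
  have V2: "?y \<in> V2" "\<Phi> ?x \<in> V2"
    using quotient_action_funpow_closed[OF target] onto v x by blast+
  have "S2 (\<Phi> ?x - ?y) \<in> I2" using Suc target by (auto simp: quotient_action_def)
  moreover have "S2 (\<Phi> ?x - ?y) = S2 (\<Phi> ?x) - S2 ?y" using target V2 by (simp add: quotient_action_def)
  ultimately have "(\<Phi> (S1 ?x) - S2 (\<Phi> ?x)) + (S2 (\<Phi> ?x) - S2 ?y) \<in> I2"
    using equivariant[OF x] add_subgroup_add target by (metis quotient_action_def)
  then show ?case by simp
qed

lemma image_class_orbit:
  assumes v: "v \<in> V1"
  shows "class_orbit S2 (\<Phi> ` quot_class V1 I1 v) = image \<Phi> ` class_orbit S1 (quot_class V1 I1 v)"
proof -
  have "(S2 ^^ n) ` \<Phi> ` quot_class V1 I1 v = \<Phi> ` (S1 ^^ n) ` quot_class V1 I1 v" for n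
  proof -
    have x: "(S1 ^^ n) v \<in> V1" "\<Phi> v \<in> V2"
      using quotient_action_funpow_closed[OF source v] onto v by auto
    have "(S2 ^^ n) ` \<Phi> ` quot_class V1 I1 v = quot_class V2 I2 ((S2 ^^ n) (\<Phi> v))"
      using image_quot_class[OF v] quotient_action_funpow_image_class[OF target x(2)] by simp
    also have "\<dots> = quot_class V2 I2 (\<Phi> ((S1 ^^ n) v))"
    proof -
      have "add_subgroup I2" using target by (simp add: quotient_action_def)
      moreover have "\<Phi> ((S1 ^^ n) v) \<in> V2" "(S2 ^^ n) (\<Phi> v) \<in> V2"
        using onto x quotient_action_funpow_closed[OF target x(2)] by auto
      ultimately show ?thesis
        using quot_class_eq_iff funpow_equivariant[OF v] by metis
    qed
    also have "\<dots> = \<Phi> ` (S1 ^^ n) ` quot_class V1 I1 v"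
      using image_quot_class[OF x(1)] quotient_action_funpow_image_class[OF source v] by simp
    finally show ?thesis .
  qed
  then show ?thesis by (auto simp: class_orbit_def)
qed

lemma image_torsion_classes:
  "image \<Phi> ` torsion_classes V1 I1 zmult1 = torsion_classes V2 I2 zmult2"
proof (intro equalityI subsetI)
  fix D assume "D \<in> image \<Phi> ` torsion_classes V1 I1 zmult1"
  then obtain v n where "v \<in> V1" "n > 0" "zmult1 n v \<in> I1" "D = \<Phi> ` quot_class V1 I1 v"
    by (auto simp: torsion_classes_def)
  moreover have "zmult1 n v \<in> V1" using source \<open>v \<in> V1\<close> by (simp add: quotient_action_def)
  ultimately show "D \<in> torsion_classes V2 I2 zmult2"
    using preimage zmult onto image_quot_class by (auto simp: torsion_classes_def)
next
  fix D assume "D \<in> torsion_classes V2 I2 zmult2"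
  then obtain v n where v: "v \<in> V1" "n > 0" "zmult2 n (\<Phi> v) \<in> I2" "D = quot_class V2 I2 (\<Phi> v)"
    using onto by (auto simp: torsion_classes_def)
  moreover have "zmult1 n v \<in> V1" using source v by (simp add: quotient_action_def)
  ultimately have "zmult1 n v \<in> I1" using preimage zmult by simp
  then have "quot_class V1 I1 v \<in> torsion_classes V1 I1 zmult1"
    using v by (auto simp: torsion_classes_def)
  then show "D \<in> image \<Phi> ` torsion_classes V1 I1 zmult1" using v image_quot_class by auto
qed

theorem torsion_orbit_count_eq:
  "torsion_orbit_count V1 I1 zmult1 S1 = torsion_orbit_count V2 I2 zmult2 S2"
proof -
  let ?T = "torsion_classes V1 I1 zmult1" and ?Cl = "quot_class V1 I1 ` V1"
  have T: "?T \<subseteq> ?Cl" by (auto simp: torsion_classes_def)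
  have orbits: "class_orbit S1 C \<subseteq> ?Cl" if "C \<in> ?Cl" for C
    using that quotient_action_funpow_image_class[OF source] quotient_action_funpow_closed[OF source]
    by (auto simp: class_orbit_def)
  have orbit: "class_orbit S2 (\<Phi> ` C) = image \<Phi> ` class_orbit S1 C" if "C \<in> ?T" for C
    using that image_class_orbit by (auto simp: torsion_classes_def)
  have "class_orbit S2 ` torsion_classes V2 I2 zmult2 = class_orbit S2 ` image \<Phi> ` ?T"
    by (simp only: image_torsion_classes)
  also have "\<dots> = image (image \<Phi>) ` class_orbit S1 ` ?T"
    unfolding image_image by (rule image_cong[OF refl orbit])
  finally have "class_orbit S2 ` torsion_classes V2 I2 zmult2 = image (image \<Phi>) ` class_orbit S1 ` ?T" .
  moreover have "inj_on (image (image \<Phi>)) (class_orbit S1 ` ?T)"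
  proof (rule inj_onI)
    fix X1 X2 assume X: "X1 \<in> class_orbit S1 ` ?T" "X2 \<in> class_orbit S1 ` ?T"
      and eq: "image \<Phi> ` X1 = image \<Phi> ` X2"
    obtain C1 C2 where "C1 \<in> ?T" "C2 \<in> ?T" "X1 = class_orbit S1 C1" "X2 = class_orbit S1 C2"
      using X by blast
    then have "X1 \<subseteq> ?Cl" "X2 \<subseteq> ?Cl" using orbits[OF subsetD[OF T]] by simp_all
    then show "X1 = X2" using inj_on_image_eq_iff[OF inj_on_image_classes] eq by metis
  qed
  ultimately show ?thesis unfolding torsion_orbit_count_def by (metis card_image)
qed

end

section \<open>Burnside's lemma for a cyclic group\<close>

lemma funpow_mod_period:
  assumes "(f ^^ p) x = x"
  shows "(f ^^ n) x = (f ^^ (n mod p)) x"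
proof -
  have periodic: "(f ^^ (p * q)) x = x" for q
    by (induction q) (simp_all add: funpow_add assms)
  have "(f ^^ n) x = (f ^^ (n mod p) \<circ> f ^^ (p * (n div p))) x"
    by (simp only: funpow_add[symmetric] mod_mult_div_eq)
  then show ?thesis using periodic by simp
qed

lemma funpow_closed: "f ` X \<subseteq> X \<Longrightarrow> x \<in> X \<Longrightarrow> (f ^^ n) x \<in> X"
  by (induction n) auto

lemma bij_betw_funpow_period:
  assumes fX: "f ` X \<subseteq> X" and per: "\<And>x. x \<in> X \<Longrightarrow> (f ^^ p) x = x" and p: "p > 0"
  shows "bij_betw f X X"
proof (rule bij_betw_byWitness[where f' = "f ^^ (p - 1)"])
  have inverse: "(f ^^ (p - 1)) (f x) = x" if "x \<in> X" for x
  proof -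
    have "(f ^^ (p - 1)) (f x) = (f ^^ Suc (p - 1)) x" by (simp only: funpow_Suc_right comp_apply)
    then show ?thesis using per[OF that] p by simp
  qed
  then show "\<forall>x\<in>X. (f ^^ (p - 1)) (f x) = x" by blast
  show "\<forall>x\<in>X. f ((f ^^ (p - 1)) x) = x" using inverse by (simp add: funpow_swap1)
  show "(f ^^ (p - 1)) ` X \<subseteq> X" using funpow_closed[OF fX] by blast
qed (rule fX)

lemma group_action_funpow:
  assumes fX: "f ` X \<subseteq> X" and per: "\<And>x. x \<in> X \<Longrightarrow> (f ^^ p) x = x" and p: "p > 0"
  shows "group_action (integer_mod_group p) X (\<lambda>j. \<lambda>x\<in>X. (f ^^ nat j) x)"
  unfolding group_action_def group_hom_def group_hom_axioms_def hom_def
proof (intro conjI CollectI ballI)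
  have Bij: "restrict (f ^^ n) X \<in> Bij X" for n
    using bij_betw_funpow_period[OF assms]
    by (simp add: Bij_def bij_betw_funpow cong: bij_betw_cong)
  then show "(\<lambda>j. \<lambda>x\<in>X. (f ^^ nat j) x) \<in> carrier (integer_mod_group p) \<rightarrow> carrier (BijGroup X)"
    by (simp add: BijGroup_def)
  fix i j assume "i \<in> carrier (integer_mod_group p)" "j \<in> carrier (integer_mod_group p)"
  then obtain a b where ab: "i = int a" "j = int b"
    using p by (auto simp: carrier_integer_mod_group intro!: that[of "nat i" "nat j"])
  have "(f ^^ ((a + b) mod p)) x = (f ^^ a) ((f ^^ b) x)" if "x \<in> X" for x
    using funpow_mod_period[OF per[OF that], of "a + b"] by (simp add: funpow_add)
  then show "(\<lambda>x\<in>X. (f ^^ nat (i \<otimes>\<^bsub>integer_mod_group p\<^esub> j)) x) =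
      (\<lambda>x\<in>X. (f ^^ nat i) x) \<otimes>\<^bsub>BijGroup X\<^esub> (\<lambda>x\<in>X. (f ^^ nat j) x)"
    using Bij funpow_closed[OF fX]
    by (auto simp: ab BijGroup_def compose_def fun_eq_iff nat_mod_distrib nat_add_distrib)
qed (simp_all add: group_BijGroup)

lemma card_funpow_orbits:
  assumes X: "finite X" and fX: "f ` X \<subseteq> X" and per: "\<And>x. x \<in> X \<Longrightarrow> (f ^^ p) x = x"
    and p: "p > 0"
  shows "p * card ((\<lambda>x. range (\<lambda>n. (f ^^ n) x)) ` X) = (\<Sum>j<p. card {x\<in>X. (f ^^ j) x = x})"
proof -
  let ?G = "integer_mod_group p" and ?\<phi> = "\<lambda>j. \<lambda>x\<in>X. (f ^^ nat j) x"
  interpret group_action ?G X ?\<phi> by (rule group_action_funpow[OF fX per p])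
  have carrier_G: "carrier ?G = int ` {..<p}"
    using p by (simp add: carrier_integer_mod_group image_int_atLeastLessThan lessThan_atLeast0)
  have "orbit ?G ?\<phi> x = range (\<lambda>n. (f ^^ n) x)" if x: "x \<in> X" for x
  proof -
    have "orbit ?G ?\<phi> x = (\<lambda>g. ?\<phi> g x) ` carrier ?G" by (auto simp: orbit_def)
    also have "\<dots> = (\<lambda>n. (f ^^ n) x) ` {..<p}" using x by (simp add: carrier_G image_image)
    also have "\<dots> = range (\<lambda>n. (f ^^ n) x)"
    proof (intro equalityI subsetI)
      fix y assume "y \<in> range (\<lambda>n. (f ^^ n) x)"
      then obtain n where "y = (f ^^ (n mod p)) x" using funpow_mod_period[OF per[OF x]] by auto
      then show "y \<in> (\<lambda>n. (f ^^ n) x) ` {..<p}" using p by simp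
    qed auto
    finally show ?thesis .
  qed
  then have orbits: "orbits ?G X ?\<phi> = (\<lambda>x. range (\<lambda>n. (f ^^ n) x)) ` X"
    by (auto simp: orbits_def)
  have order: "order ?G = p" by (simp add: order_def carrier_G card_image)
  have "invariants X ?\<phi> (int j) = {x\<in>X. (f ^^ j) x = x}" for j
    by (auto simp: invariants_def)
  then have invariants:
    "(\<Sum>g\<in>carrier ?G. card (invariants X ?\<phi> g)) = (\<Sum>j<p. card {x\<in>X. (f ^^ j) x = x})"
    by (simp add: carrier_G sum.reindex)
  have "finite (carrier ?G)" by (simp add: carrier_G)
  from burnside[OF this X]
  have "card ((\<lambda>x. range (\<lambda>n. (f ^^ n) x)) ` X) * p = (\<Sum>j<p. card {x\<in>X. (f ^^ j) x = x})"
    unfolding orbits order invariants .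
  then show ?thesis by (simp only: mult.commute)
qed

lemma card_involution_orbits:
  assumes X: "finite X" and fX: "f ` X \<subseteq> X" and inv: "\<And>x. x \<in> X \<Longrightarrow> f (f x) = x"
  shows "2 * card ((\<lambda>x. range (\<lambda>n. (f ^^ n) x)) ` X) = card X + card {x\<in>X. f x = x}"
proof -
  have "2 * card ((\<lambda>x. range (\<lambda>n. (f ^^ n) x)) ` X) = (\<Sum>j<2. card {x\<in>X. (f ^^ j) x = x})"
    using inv by (intro card_funpow_orbits[OF X fX]) (simp_all add: numeral_2_eq_2)
  also have "\<dots> = card X + card {x\<in>X. f x = x}" by (simp add: numeral_2_eq_2)
  finally show ?thesis .
qed

section \<open>Integer \<open>2 \<times> 2\<close> matrices\<close>

lemmas mat2_expand = vec_eq_iff forall_2 matrix_matrix_mult_def matrix_vector_mult_def sum_2 mat_def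

definition mat2 :: "int \<Rightarrow> int \<Rightarrow> int \<Rightarrow> int \<Rightarrow> imat2" where
  "mat2 a b c d = vector [vector [a, b], vector [c, d]]"

lemma mat2_nth [simp]:
  "mat2 a b c d $1$1 = a" "mat2 a b c d $1$2 = b" "mat2 a b c d $2$1 = c" "mat2 a b c d $2$2 = d"
  by (simp_all add: mat2_def)

lemma mat2_eta: "g = mat2 (g$1$1) (g$1$2) (g$2$1) (g$2$2)"
  by (simp add: vec_eq_iff forall_2)

definition vec2 :: "int \<Rightarrow> int \<Rightarrow> int^2" where
  "vec2 a b = vector [a, b]"

lemma vec2_nth [simp]: "vec2 a b $1 = a" "vec2 a b $2 = b"
  by (simp_all add: vec2_def)

lemma vec2_diff [simp]: "vec2 a b - vec2 c d = vec2 (a - c) (b - d)"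
  by (simp add: vec_eq_iff forall_2)

lemma vec2_eq_iff [simp]: "vec2 a b = vec2 c d \<longleftrightarrow> a = c \<and> b = d"
  by (auto simp: vec_eq_iff forall_2)

lemma matrix_vector_mult_mat2:
  "mat2 a b c d *v x = vec2 (a * x$1 + b * x$2) (c * x$1 + d * x$2)"
  by (simp add: mat2_expand)

lemma trace2: "trace (M::imat2) = M$1$1 + M$2$2"
  by (simp add: trace_def sum_2)

definition adjugate2 :: "imat2 \<Rightarrow> imat2" where
  "adjugate2 g = mat2 (g$2$2) (- g$1$2) (- g$2$1) (g$1$1)"

lemma matrix_mult_adjugate2: "g ** adjugate2 g = mat (det g)"
  by (simp add: adjugate2_def mat2_expand det_2 algebra_simps)

lemma adjugate2_mult_matrix: "adjugate2 g ** g = mat (det g)"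
  by (simp add: adjugate2_def mat2_expand det_2 algebra_simps)

lemma matrix_diff_ldistrib: "(A::imat2) ** (B - C) = A ** B - A ** C"
  by (simp add: mat2_expand algebra_simps)

lemma matrix_diff_rdistrib: "((A::imat2) - B) ** C = A ** C - B ** C"
  by (simp add: mat2_expand algebra_simps)

lemma matrix_add_rdistrib: "((A::imat2) + B) ** C = A ** C + B ** C"
  by (simp add: mat2_expand algebra_simps)

lemma mat_add: "mat (x + y) = mat x + (mat y :: imat2)"
  by (simp add: mat2_expand)

lemma matrix_mult_mat_commute: "(A::imat2) ** mat c = mat c ** A"
  by (simp add: mat2_expand algebra_simps)

lemma matrix_vector_mult_mat: "mat c *v x = c *s (x::int^2)"
  by (simp add: mat2_expand)

lemma matrix_vector_mult_smult: "(A::imat2) *v (c *s x) = c *s (A *v x)"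
  by (simp add: mat2_expand algebra_simps)

lemma matrix_vector_mult_cancel:
  fixes N :: imat2
  assumes "det N \<noteq> 0" "N *v x = N *v y"
  shows "x = y"
proof -
  have "adjugate2 N *v (N *v x) = adjugate2 N *v (N *v y)" using assms by simp
  then have "det N *s x = det N *s y"
    by (simp add: matrix_vector_mul_assoc adjugate2_mult_matrix matrix_vector_mult_mat)
  then show ?thesis using assms(1) by (simp add: vec_eq_iff)
qed

lemma invertible_det_1:
  assumes "det (P::imat2) = 1"
  shows "P ** adjugate2 P = mat 1" "adjugate2 P ** P = mat 1"
  using assms by (simp_all add: matrix_mult_adjugate2 adjugate2_mult_matrix)

lemma right_inverse_imp_left_inverse:
  assumes "det (P::imat2) = 1" "P ** Q = mat 1"
  shows "Q ** P = mat 1"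
proof -
  have "Q = adjugate2 P ** (P ** Q)" using assms(1) by (simp add: matrix_mul_assoc invertible_det_1)
  then show ?thesis using assms by (simp add: invertible_det_1)
qed

lemma mat_pow_add: "mat_pow g (a + b) = mat_pow g a ** mat_pow g b"
  by (induction a) (auto simp: matrix_mul_assoc)

lemma mat_pow_Suc_right: "mat_pow g (Suc n) = mat_pow g n ** g"
  using mat_pow_add[of g n 1] by simp

lemma mat_pow_commute: "mat_pow g a ** mat_pow g b = mat_pow g b ** mat_pow g a"
  by (metis add.commute mat_pow_add)

lemma mat_pow_mult: "mat_pow (mat_pow g a) b = mat_pow g (a * b)"
  by (induction b) (auto simp: mat_pow_add[symmetric] add.commute)

lemma mat_pow_one [simp]: "mat_pow (mat 1) n = mat 1"
  by (induction n) simp_all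

lemma det_mat_pow: "det g = 1 \<Longrightarrow> det (mat_pow g n) = 1"
  by (induction n) (auto simp: det_mul)

lemma mat_pow_conj:
  assumes "P ** Q = mat 1" "Q ** P = mat 1"
  shows "mat_pow (P ** h ** Q) n = P ** mat_pow h n ** Q"
proof (induction n)
  case (Suc n)
  have "P ** h ** Q ** (P ** mat_pow h n ** Q) = P ** h ** (Q ** P) ** mat_pow h n ** Q"
    by (simp add: matrix_mul_assoc)
  then show ?case using Suc assms by (simp add: matrix_mul_assoc)
qed (use assms in simp)

lemma one_minus_mat_pow_commute:
  "(mat 1 - mat_pow g k) ** mat_pow g m = mat_pow g m ** (mat 1 - mat_pow g k)"
  by (simp add: matrix_diff_ldistrib matrix_diff_rdistrib mat_pow_commute)

section \<open>Quotients of \<open>\<int>\<^sup>2\<close> by the column lattice of a matrix\<close>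

definition col_lattice :: "imat2 \<Rightarrow> (int^2) set" where
  "col_lattice A = range (\<lambda>x. A *v x)"

lemma add_subgroup_col_lattice: "add_subgroup (col_lattice A)"
  unfolding add_subgroup_def col_lattice_def
proof (intro conjI ballI)
  show "0 \<in> range ((*v) A)" by (metis rangeI matrix_vector_mult_0_right)
  fix a b assume "a \<in> range ((*v) A)" "b \<in> range ((*v) A)"
  then show "a - b \<in> range ((*v) A)" by (auto simp: matrix_vector_mult_diff_distrib[symmetric])
qed

lemma col_lattice_mult_unimodular:
  assumes "U ** U' = mat 1"
  shows "col_lattice (D ** U) = col_lattice D"
  unfolding col_lattice_def
proof (auto simp: matrix_vector_mul_assoc[symmetric])
  fix x
  have "D *v x = D *v (U *v (U' *v x))" by (simp add: matrix_vector_mul_assoc assms)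
  then show "D *v x \<in> range (\<lambda>x. D *v (U *v x))" by blast
qed

lemma unimodular_column_reduction:
  fixes D :: imat2
  obtains U U' :: imat2 where "U ** U' = mat 1" "U' ** U = mat 1" "(D ** U)$2$1 = 0"
proof (cases "D$2$1 = 0")
  case True
  then show ?thesis by (intro that[of "mat 1" "mat 1"]) simp_all
next
  case False
  define c d where "c = D$2$1" and "d = D$2$2"
  define g where "g = gcd c d"
  have g0: "g \<noteq> 0" using False by (simp add: g_def c_def)
  obtain c' d' where c': "c = g * c'" and d': "d = g * d'"
    unfolding g_def by (meson gcd_dvd1 gcd_dvd2 dvdE)
  obtain s t where "s * c + t * d = g" unfolding g_def using bezout_int by blast
  then have "g * (s * c' + t * d') = g * 1" using c' d' by (simp add: algebra_simps)
  then have st: "s * c' + t * d' = 1" using g0 mult_left_cancel by blast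
  show ?thesis
  proof (rule that[of "mat2 d' s (- c') t" "mat2 t (- s) c' d'"])
    show "mat2 d' s (- c') t ** mat2 t (- s) c' d' = mat 1"
      "mat2 t (- s) c' d' ** mat2 d' s (- c') t = mat 1"
      using st by (simp_all add: mat2_expand algebra_simps)
    show "(D ** mat2 d' s (- c') t) $ 2 $ 1 = 0"
      by (simp add: mat2_expand c_def[symmetric] d_def[symmetric] c' d' algebra_simps)
  qed
qed

lemma abs_det_unimodular:
  assumes "U ** U' = mat 1"
  shows "\<bar>det (U::imat2)\<bar> = 1"
proof -
  have "det U * det U' = 1" using assms det_mul[of U U'] by simp
  then show ?thesis using zmult_eq_1_iff by (metis abs_1 abs_neg_one)
qed

lemma triangular_col_lattice_transversal:
  fixes p q s :: int
  assumes p: "p \<noteq> 0" and s: "s \<noteq> 0"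
  defines "H \<equiv> mat2 p q 0 s"
  defines "R \<equiv> (\<lambda>(x, y). vec2 x y) ` ({0..<\<bar>p\<bar>} \<times> {0..<\<bar>s\<bar>})"
  shows "\<exists>r\<in>R. y - r \<in> col_lattice H"
    and "r \<in> R \<Longrightarrow> r' \<in> R \<Longrightarrow> r - r' \<in> col_lattice H \<Longrightarrow> r = r'"
proof -
  note Hv = matrix_vector_mult_mat2[of p q 0 s, simplified, folded H_def]
  define b where "b = (y$2 div \<bar>s\<bar>) * sgn s"
  define a where "a = ((y$1 - q * b) div \<bar>p\<bar>) * sgn p"
  have "s * sgn s = \<bar>s\<bar>" "p * sgn p = \<bar>p\<bar>" by (simp_all add: abs_sgn)
  then have "s * b = y$2 - y$2 mod \<bar>s\<bar>" "p * a = (y$1 - q * b) - (y$1 - q * b) mod \<bar>p\<bar>"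
    unfolding a_def b_def by (simp_all add: minus_mod_eq_mult_div mult.left_commute)
  then have "y - vec2 ((y$1 - q * b) mod \<bar>p\<bar>) (y$2 mod \<bar>s\<bar>) = H *v vec2 a b"
    by (simp add: Hv vec_eq_iff forall_2)
  moreover have "vec2 ((y$1 - q * b) mod \<bar>p\<bar>) (y$2 mod \<bar>s\<bar>) \<in> R"
    unfolding R_def using p s by auto
  ultimately show "\<exists>r\<in>R. y - r \<in> col_lattice H" unfolding col_lattice_def by (metis rangeI)
next
  note Hv = matrix_vector_mult_mat2[of p q 0 s, simplified, folded H_def]
  assume "r \<in> R" "r' \<in> R" "r - r' \<in> col_lattice H"
  then obtain x1 y1 x2 y2 w where xy: "r = vec2 x1 y1" "r' = vec2 x2 y2"
    "0 \<le> x1" "x1 < \<bar>p\<bar>" "0 \<le> y1" "y1 < \<bar>s\<bar>" "0 \<le> x2" "x2 < \<bar>p\<bar>" "0 \<le> y2" "y2 < \<bar>s\<bar>"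
    and w: "r - r' = H *v w"
    unfolding R_def col_lattice_def by auto
  have small: "z = 0" if "c * z = u - v" "0 \<le> u" "u < \<bar>c\<bar>" "0 \<le> v" "v < \<bar>c\<bar>" for c z u v :: int
  proof (rule ccontr)
    assume "z \<noteq> 0"
    then have "\<bar>c\<bar> * 1 \<le> \<bar>c\<bar> * \<bar>z\<bar>" by (intro mult_left_mono) auto
    then have "\<bar>c\<bar> \<le> \<bar>c * z\<bar>" by (simp add: abs_mult)
    then show False using that by linarith
  qed
  have "y1 - y2 = s * w$2" using w xy by (simp add: Hv)
  then have "w$2 = 0" using small xy by metis
  moreover have "x1 - x2 = p * w$1 + q * w$2" using w xy by (simp add: Hv)
  ultimately have "w$1 = 0" using small[of p "w$1" x1 x2] xy by simp
  then show "r = r'" using w xy \<open>w$2 = 0\<close> by (simp add: Hv)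
qed

lemma col_lattice_transversal:
  fixes D :: imat2
  assumes "det D \<noteq> 0"
  obtains R where "finite R" "card R = nat \<bar>det D\<bar>" "\<And>y. \<exists>r\<in>R. y - r \<in> col_lattice D"
    "\<And>r r'. r \<in> R \<Longrightarrow> r' \<in> R \<Longrightarrow> r - r' \<in> col_lattice D \<Longrightarrow> r = r'"
proof -
  obtain U U' :: imat2 where U: "U ** U' = mat 1" and H0: "(D ** U)$2$1 = 0"
    by (rule unimodular_column_reduction)
  define p q s where "p = (D ** U)$1$1" and "q = (D ** U)$1$2" and "s = (D ** U)$2$2"
  have H: "D ** U = mat2 p q 0 s" using H0 by (simp add: p_def q_def s_def vec_eq_iff forall_2)
  have "\<bar>det (D ** U)\<bar> = \<bar>det D\<bar>" by (simp add: det_mul abs_mult abs_det_unimodular[OF U])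
  moreover have "det (D ** U) = p * s" unfolding H by (simp add: det_2)
  ultimately have "\<bar>p * s\<bar> = \<bar>det D\<bar>" by simp
  then have ps: "p \<noteq> 0" "s \<noteq> 0" "nat \<bar>p\<bar> * nat \<bar>s\<bar> = nat \<bar>det D\<bar>"
    using assms by (auto simp: abs_mult simp flip: nat_mult_distrib)
  define R where "R = (\<lambda>(x, y). vec2 x y) ` ({0..<\<bar>p\<bar>} \<times> {0..<\<bar>s\<bar>})"
  have "card R = card ({0..<\<bar>p\<bar>} \<times> {0..<\<bar>s\<bar>})"
    unfolding R_def by (rule card_image) (auto simp: inj_on_def)
  then have card: "card R = nat \<bar>det D\<bar>" using ps by (simp add: card_cartesian_product)
  have lattice: "col_lattice D = col_lattice (mat2 p q 0 s)"
    using col_lattice_mult_unimodular[OF U, of D] H by simp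
  show ?thesis
  proof (rule that[OF _ card])
    show "finite R" unfolding R_def by simp
    show "\<exists>r\<in>R. y - r \<in> col_lattice D" for y
      unfolding lattice R_def by (rule triangular_col_lattice_transversal(1)[OF ps(1,2)])
    show "r = r'" if "r \<in> R" "r' \<in> R" "r - r' \<in> col_lattice D" for r r'
      using that unfolding lattice R_def by (rule triangular_col_lattice_transversal(2)[OF ps(1,2)])
  qed
qed

lemma card_quotient_col_lattice_mult:
  fixes N D :: imat2
  assumes dD: "det D \<noteq> 0" and dN: "det N \<noteq> 0"
  shows "card (quot_class UNIV (col_lattice (N ** D)) ` col_lattice N) = nat \<bar>det D\<bar>"
proof -
  obtain R where R: "finite R" "card R = nat \<bar>det D\<bar>" "\<And>y. \<exists>r\<in>R. y - r \<in> col_lattice D"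
     "\<And>r r'. r \<in> R \<Longrightarrow> r' \<in> R \<Longrightarrow> r - r' \<in> col_lattice D \<Longrightarrow> r = r'"
    using col_lattice_transversal[OF dD] by blast
  have "card ((\<lambda>x. N *v x) ` R) = card R"
    by (rule card_image) (meson inj_onI matrix_vector_mult_cancel dN)
  moreover have "card (quot_class UNIV (col_lattice (N ** D)) ` col_lattice N) = card ((\<lambda>x. N *v x) ` R)"
  proof (rule card_quot_class_image_transversal[OF add_subgroup_col_lattice])
    show "(\<lambda>x. N *v x) ` R \<subseteq> col_lattice N" by (auto simp: col_lattice_def)
  next
    fix y assume "y \<in> col_lattice N"
    then obtain z where z: "y = N *v z" by (auto simp: col_lattice_def)
    obtain r u where r: "r \<in> R" "z - r = D *v u" using R(3)[of z] by (auto simp: col_lattice_def)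
    have "y - N *v r = (N ** D) *v u"
      using r z by (simp add: matrix_vector_mult_diff_distrib[symmetric] matrix_vector_mul_assoc[symmetric])
    then show "\<exists>r\<in>(\<lambda>x. N *v x) ` R. y - r \<in> col_lattice (N ** D)"
      using r unfolding col_lattice_def by blast
  next
    fix a b assume "a \<in> (\<lambda>x. N *v x) ` R" "b \<in> (\<lambda>x. N *v x) ` R" "a - b \<in> col_lattice (N ** D)"
    then obtain r r' u where rr: "r \<in> R" "r' \<in> R" "a = N *v r" "b = N *v r'"
      "N *v (r - r') = N *v (D *v u)"
      by (auto simp: col_lattice_def matrix_vector_mul_assoc matrix_vector_mult_diff_distrib)
    then have "r - r' = D *v u" using matrix_vector_mult_cancel dN by blast
    then show "a = b" using R(4) rr by (auto simp: col_lattice_def)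
  qed
  ultimately show ?thesis using R by simp
qed

lemma card_quotient_col_lattice:
  assumes "det D \<noteq> 0"
  shows "card (range (quot_class UNIV (col_lattice D))) = nat \<bar>det D\<bar>"
proof -
  have "range (\<lambda>x. mat 1 *v x) = (UNIV :: (int^2) set)" by simp
  then have "col_lattice (mat 1) = UNIV" by (simp only: col_lattice_def)
  moreover have "card (quot_class UNIV (col_lattice (mat 1 ** D)) ` col_lattice (mat 1)) = nat \<bar>det D\<bar>"
    by (rule card_quotient_col_lattice_mult[OF assms]) simp
  ultimately show ?thesis by (simp only: matrix_mul_lid)
qed

lemma finite_quotient_col_lattice:
  assumes "det D \<noteq> 0"
  shows "finite (range (quot_class UNIV (col_lattice D)))"
proof (rule ccontr)
  assume "infinite (range (quot_class UNIV (col_lattice D)))"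
  then show False using card_quotient_col_lattice[OF assms] assms by simp
qed

lemma torsion_classes_col_lattice:
  assumes "det A \<noteq> 0"
  shows "torsion_classes UNIV (col_lattice A) (*s) = range (quot_class UNIV (col_lattice A))"
proof -
  have "\<bar>det A\<bar> *s x \<in> col_lattice A" for x
  proof -
    have "A *v (sgn (det A) *s (adjugate2 A *v x)) = (sgn (det A) * det A) *s x"
      by (simp add: matrix_vector_mult_smult matrix_vector_mul_assoc matrix_mult_adjugate2
          matrix_vector_mult_mat)
    also have "sgn (det A) * det A = \<bar>det A\<bar>" by (simp add: abs_sgn mult.commute)
    finally show ?thesis unfolding col_lattice_def by (rule range_eqI[OF sym])
  qed
  then show ?thesis using assms by (auto simp: torsion_classes_def intro!: exI[of _ "\<bar>det A\<bar>"])
qed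

definition lattice_orbit_count :: "imat2 \<Rightarrow> imat2 \<Rightarrow> nat" where
  "lattice_orbit_count A B = torsion_orbit_count UNIV (col_lattice A) (*s) (\<lambda>x. B *v x)"

lemma quotient_action_col_lattice:
  fixes A B B' :: imat2
  assumes BB: "B ** B' = mat 1" "B' ** B = mat 1" and AB: "A ** B = B ** A"
  shows "quotient_action UNIV (col_lattice A) (*s) (\<lambda>x. B *v x)"
proof -
  have "A ** B' = B' ** B ** A ** B'" using BB by (simp add: matrix_mul_assoc)
  also have "\<dots> = B' ** (A ** B) ** B'" using AB by (simp add: matrix_mul_assoc)
  also have "\<dots> = B' ** A" using BB by (simp add: matrix_mul_assoc[symmetric])
  finally have AB': "A ** B' = B' ** A" .
  have bij: "bij_betw (\<lambda>x. B *v x) UNIV UNIV"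
    by (rule bij_betwI[where g = "\<lambda>x. B' *v x"]) (simp_all add: matrix_vector_mul_assoc BB)
  have "(\<lambda>x. B *v x) ` col_lattice A = col_lattice A"
  proof (intro equalityI subsetI)
    fix y assume "y \<in> (\<lambda>x. B *v x) ` col_lattice A"
    then obtain x where "y = B *v (A *v x)" by (auto simp: col_lattice_def)
    then have "y = A *v (B *v x)" using AB by (simp add: matrix_vector_mul_assoc)
    then show "y \<in> col_lattice A" by (auto simp: col_lattice_def)
  next
    fix y assume "y \<in> col_lattice A"
    then obtain x where "y = A *v x" by (auto simp: col_lattice_def)
    then have "y = B *v (A *v (B' *v x))"
      using BB AB' by (simp add: matrix_vector_mul_assoc matrix_mul_assoc)
    then show "y \<in> (\<lambda>x. B *v x) ` col_lattice A" by (auto simp: col_lattice_def)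
  qed
  then show ?thesis
    using add_subgroup_col_lattice[of A] bij
    by (auto simp: quotient_action_def add_subgroup_def matrix_vector_mult_diff_distrib)
qed

lemma quotient_action_mat_pow:
  assumes "det g = 1"
  shows "quotient_action UNIV (col_lattice (mat 1 - mat_pow g k)) (*s) (\<lambda>x. mat_pow g m *v x)"
  using invertible_det_1[OF det_mat_pow[OF assms]]
  by (intro quotient_action_col_lattice one_minus_mat_pow_commute)

lemma lattice_orbit_count_conj:
  fixes A B B' P Q :: imat2
  assumes BB: "B ** B' = mat 1" "B' ** B = mat 1" and AB: "A ** B = B ** A"
    and PQ: "P ** Q = mat 1" "Q ** P = mat 1"
  shows "lattice_orbit_count (P ** A ** Q) (P ** B ** Q) = lattice_orbit_count A B"
proof -
  have cancel: "X ** Q ** P = X" "X ** B ** B' = X" "X ** B' ** B = X" for X :: imat2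
    using PQ BB by (simp_all add: matrix_mul_assoc[symmetric])
  have ABX: "X ** A ** B = X ** B ** A" for X :: imat2
    using AB by (simp add: matrix_mul_assoc[symmetric])
  have target: "quotient_action UNIV (col_lattice (P ** A ** Q)) (*s) (\<lambda>x. (P ** B ** Q) *v x)"
    by (rule quotient_action_col_lattice[where B' = "P ** B' ** Q"])
      (simp_all add: matrix_mul_assoc cancel ABX PQ)
  have lattice: "v \<in> col_lattice A \<longleftrightarrow> P *v v \<in> col_lattice (P ** A ** Q)" for v
  proof
    assume "v \<in> col_lattice A"
    then obtain u where "v = A *v u" by (auto simp: col_lattice_def)
    then have "P *v v = (P ** A ** Q) *v (P *v u)"
      by (simp add: matrix_vector_mul_assoc matrix_mul_assoc cancel)
    then show "P *v v \<in> col_lattice (P ** A ** Q)" by (auto simp: col_lattice_def)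
  next
    assume "P *v v \<in> col_lattice (P ** A ** Q)"
    then obtain u where "Q *v (P *v v) = Q *v ((P ** A ** Q) *v u)" by (auto simp: col_lattice_def)
    then have "v = A *v (Q *v u)"
      using PQ by (simp add: matrix_vector_mul_assoc matrix_mul_assoc cancel)
    then show "v \<in> col_lattice A" by (auto simp: col_lattice_def)
  qed
  interpret quotient_action_hom UNIV "col_lattice A" "(*s)" "\<lambda>x. B *v x"
    UNIV "col_lattice (P ** A ** Q)" "(*s)" "\<lambda>x. (P ** B ** Q) *v x" "\<lambda>x. P *v x"
  proof
    show "quotient_action UNIV (col_lattice A) (*s) (\<lambda>x. B *v x)"
      by (rule quotient_action_col_lattice[OF BB AB])
    show "range (\<lambda>x. P *v x) = UNIV"
      using PQ by (metis matrix_vector_mul_assoc matrix_vector_mul_lid surj_def)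
    show "P *v (B *v v) - (P ** B ** Q) *v (P *v v) \<in> col_lattice (P ** A ** Q)" for v
      using add_subgroup_col_lattice
      by (simp add: matrix_vector_mul_assoc matrix_mul_assoc cancel add_subgroup_def PQ)
  qed (simp_all add: target lattice matrix_vector_mult_diff_distrib matrix_vector_mult_smult)
  show ?thesis unfolding lattice_orbit_count_def by (rule torsion_orbit_count_eq[symmetric])
qed

section \<open>Reduction from \<open>\<int>\<^sup>2\<^sup>k\<close> to \<open>\<int>\<^sup>2\<close>\<close>

definition block :: "(nat \<Rightarrow> int) \<Rightarrow> nat \<Rightarrow> int^2" where
  "block v i = vec2 (v (2 * i)) (v (2 * i + 1))"

definition block_vec :: "nat \<Rightarrow> int^2 \<Rightarrow> nat \<Rightarrow> int" where
  "block_vec j y = (\<lambda>p. if p = 2 * j then y$1 else if p = 2 * j + 1 then y$2 else 0)"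

definition of_blocks :: "nat \<Rightarrow> (nat \<Rightarrow> int^2) \<Rightarrow> nat \<Rightarrow> int" where
  "of_blocks k f = (\<lambda>p. if p < 2 * k then (if even p then f (p div 2) $ 1 else f (p div 2) $ 2) else 0)"

text \<open>\<open>block_horner g v i = \<Sum>j\<le>i. g\<^sup>i\<^sup>-\<^sup>j v\<^sub>j\<close>; \<open>collapse k g\<close> transports every block of \<open>\<int>\<^sup>2\<^sup>k\<close> to the
  last one, and is the map that identifies \<open>coker (Id - w \<otimes> g)\<close> with \<open>\<int>\<^sup>2 / (1 - g\<^sup>k) \<int>\<^sup>2\<close>.\<close>

primrec block_horner :: "imat2 \<Rightarrow> (nat \<Rightarrow> int) \<Rightarrow> nat \<Rightarrow> int^2" where
  "block_horner g v 0 = block v 0"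
| "block_horner g v (Suc i) = g *v block_horner g v i + block v (Suc i)"

definition collapse :: "nat \<Rightarrow> imat2 \<Rightarrow> (nat \<Rightarrow> int) \<Rightarrow> int^2" where
  "collapse k g v = block_horner g v (k - 1)"

lemma block_ext:
  assumes "v \<in> zvecs (2 * k)" "w \<in> zvecs (2 * k)" "\<And>i. i < k \<Longrightarrow> block v i = block w i"
  shows "v = w"
proof
  fix p
  show "v p = w p"
  proof (cases "p < 2 * k")
    case True
    then have "block v (p div 2) = block w (p div 2)" by (intro assms(3)) simp
    then show ?thesis
      by (cases "even p") (auto simp: block_def elim!: evenE oddE)
  qed (use assms(1,2) in \<open>simp add: zvecs_def\<close>)
qed

lemma block_diff [simp]: "block (v - w) i = block v i - block w i"
  and block_diff' [simp]: "block (\<lambda>p. v p - w p) i = block v i - block w i"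
  and block_smult [simp]: "block (\<lambda>p. n * v p) i = n *s block v i"
  and block_block_vec [simp]: "block (block_vec j y) i = (if i = j then y else 0)"
  by (simp_all add: block_def block_vec_def vec_eq_iff forall_2)

lemma block_of_blocks [simp]: "i < k \<Longrightarrow> block (of_blocks k f) i = f i"
  by (simp add: block_def of_blocks_def vec_eq_iff forall_2)

lemma block_vec_zvecs: "j < k \<Longrightarrow> block_vec j y \<in> zvecs (2 * k)"
  and of_blocks_zvecs: "of_blocks k f \<in> zvecs (2 * k)"
  and cyc_tensor_zvecs: "cyc_tensor k g v \<in> zvecs (2 * k)"
  by (simp_all add: zvecs_def block_vec_def of_blocks_def cyc_tensor_def)

lemma add_subgroup_zvecs: "add_subgroup (zvecs n)"
  by (simp add: add_subgroup_def zvecs_def)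

lemma funpow_cyc_tensor_zvecs: "v \<in> zvecs (2 * k) \<Longrightarrow> (cyc_tensor k g ^^ n) v \<in> zvecs (2 * k)"
  by (induction n) (simp_all add: cyc_tensor_zvecs)

lemma block_cyc_tensor:
  assumes "i < k"
  shows "block (cyc_tensor k g v) i = g *v block v ((i + k - 1) mod k)"
proof -
  have "2 * i < 2 * k" "2 * i + 1 < 2 * k" "(2 * i + 1) div 2 = i" using assms by auto
  then show ?thesis by (simp add: block_def cyc_tensor_def Let_def mat2_expand vec2_def)
qed

lemma cyc_tensor_diff: "cyc_tensor k g (v - w) = cyc_tensor k g v - cyc_tensor k g w"
  by (rule ext) (simp add: cyc_tensor_def Let_def algebra_simps)

lemma cyc_tensor_zero: "cyc_tensor k g 0 = 0"
  by (rule ext) (simp add: cyc_tensor_def Let_def)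

lemma block_funpow_cyc_tensor:
  assumes "i < k"
  shows "block ((cyc_tensor k (mat 1) ^^ n) v) i = block v ((i + (k - 1) * n) mod k)"
  using assms
proof (induction n arbitrary: i)
  case (Suc n)
  have "block ((cyc_tensor k (mat 1) ^^ Suc n) v) i =
      block v (((i + k - 1) mod k + (k - 1) * n) mod k)"
    using Suc block_cyc_tensor[OF Suc.prems] by simp
  also have "((i + k - 1) mod k + (k - 1) * n) mod k = (i + k - 1 + (k - 1) * n) mod k"
    by (simp add: mod_add_left_eq)
  also have "i + k - 1 + (k - 1) * n = i + (k - 1) * Suc n" using Suc.prems by simp
  finally show ?case .
qed simp

lemma funpow_cyc_tensor_period:
  assumes "v \<in> zvecs (2 * k)"
  shows "(cyc_tensor k (mat 1) ^^ k) v = v"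
proof (cases k)
  case (Suc m)
  show ?thesis
  proof (rule block_ext[OF funpow_cyc_tensor_zvecs[OF assms] assms])
    show "block ((cyc_tensor k (mat 1) ^^ k) v) i = block v i" if "i < k" for i
      using that by (simp add: block_funpow_cyc_tensor)
  qed
qed (use assms in \<open>simp add: zvecs_def fun_eq_iff\<close>)

lemma cyc_tensor_commute:
  "cyc_tensor k g (cyc_tensor k (mat 1) v) = cyc_tensor k (mat 1) (cyc_tensor k g v)"
proof (rule block_ext[OF cyc_tensor_zvecs cyc_tensor_zvecs])
  fix i assume i: "i < k"
  then have "(i + k - 1) mod k < k" by simp
  then show "block (cyc_tensor k g (cyc_tensor k (mat 1) v)) i =
      block (cyc_tensor k (mat 1) (cyc_tensor k g v)) i"
    using i by (simp add: block_cyc_tensor)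
qed

lemma img_lattice_subset: "img_lattice k g \<subseteq> zvecs (2 * k)"
  using add_subgroup_diff[OF add_subgroup_zvecs _ cyc_tensor_zvecs] by (auto simp: img_lattice_def)

lemma add_subgroup_img_lattice: "add_subgroup (img_lattice k g)"
  unfolding add_subgroup_def img_lattice_def
proof (intro conjI ballI)
  have "0 = 0 - cyc_tensor k g 0" by (simp add: cyc_tensor_zero)
  moreover have "0 \<in> zvecs (2 * k)" by (simp add: zvecs_def)
  ultimately show "0 \<in> (\<lambda>v. v - cyc_tensor k g v) ` zvecs (2 * k)" by (rule image_eqI)
  fix a b assume "a \<in> (\<lambda>v. v - cyc_tensor k g v) ` zvecs (2 * k)"
    "b \<in> (\<lambda>v. v - cyc_tensor k g v) ` zvecs (2 * k)"
  then obtain v w where "v \<in> zvecs (2 * k)" "w \<in> zvecs (2 * k)"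
    "a - b = (v - w) - cyc_tensor k g (v - w)"
    by (auto simp: cyc_tensor_diff)
  then show "a - b \<in> (\<lambda>v. v - cyc_tensor k g v) ` zvecs (2 * k)"
    using add_subgroup_diff[OF add_subgroup_zvecs] by blast
qed

lemma quotient_action_coker:
  assumes "k \<ge> 1"
  shows "quotient_action (zvecs (2 * k)) (img_lattice k g) (\<lambda>n v p. n * v p) (cyc_tensor k (mat 1))"
proof -
  let ?S = "cyc_tensor k (mat 1)"
  obtain m where k: "k = Suc m" using assms by (cases k) auto
  have bij: "bij_betw ?S (zvecs (2 * k)) (zvecs (2 * k))"
  proof (rule bij_betwI[where g = "?S ^^ m"])
    show "?S ^^ m \<in> zvecs (2 * k) \<rightarrow> zvecs (2 * k)" using funpow_cyc_tensor_zvecs by blast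
    show "(?S ^^ m) (?S x) = x" "?S ((?S ^^ m) x) = x" if "x \<in> zvecs (2 * k)" for x
      using funpow_cyc_tensor_period[OF that] funpow_Suc_right[of m ?S]
      by (simp_all add: k del: funpow.simps) (simp add: funpow_swap1)
  qed (simp add: cyc_tensor_zvecs)
  have rotate: "?S (v - cyc_tensor k g v) = ?S v - cyc_tensor k g (?S v)" for v
    by (simp add: cyc_tensor_diff cyc_tensor_commute)
  have "?S ` img_lattice k g = img_lattice k g"
  proof (intro equalityI subsetI)
    fix x assume "x \<in> ?S ` img_lattice k g"
    then show "x \<in> img_lattice k g" using rotate cyc_tensor_zvecs by (auto simp: img_lattice_def)
  next
    fix x assume "x \<in> img_lattice k g"
    then obtain v where v: "v \<in> zvecs (2 * k)" "x = v - cyc_tensor k g v"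
      by (auto simp: img_lattice_def)
    define u where "u = (?S ^^ m) v"
    have "?S u = v" using funpow_cyc_tensor_period[OF v(1)] by (simp add: u_def k)
    then have "x = ?S (u - cyc_tensor k g u)" using v(2) rotate by simp
    moreover have "u \<in> zvecs (2 * k)" using funpow_cyc_tensor_zvecs[OF v(1)] by (simp add: u_def)
    ultimately show "x \<in> ?S ` img_lattice k g" by (auto simp: img_lattice_def)
  qed
  then show ?thesis
    using bij add_subgroup_zvecs add_subgroup_img_lattice img_lattice_subset
    by (simp add: quotient_action_def cyc_tensor_diff zvecs_def)
qed

lemma block_horner_diff: "block_horner g (v - w) i = block_horner g v i - block_horner g w i"
  by (induction i) (simp_all add: matrix_vector_mult_diff_distrib)

lemma block_horner_smult: "block_horner g (\<lambda>p. n * v p) i = n *s block_horner g v i"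
  by (induction i) (simp_all add: matrix_vector_mult_smult vector_add_ldistrib)

lemma block_horner_block_vec_above: "i \<le> j \<Longrightarrow> block_horner g (block_vec j y) i = (if i = j then y else 0)"
  by (induction i) auto

lemma block_horner_block_vec_0: "block_horner g (block_vec 0 y) i = mat_pow g i *v y"
  by (induction i) (simp_all add: matrix_vector_mul_assoc)

lemma collapse_diff: "collapse k g (v - w) = collapse k g v - collapse k g w"
  and collapse_smult: "collapse k g (\<lambda>p. n * v p) = n *s collapse k g v"
  and collapse_block_vec_last: "collapse k g (block_vec (k - 1) y) = y"
  and collapse_block_vec_0: "collapse k g (block_vec 0 y) = mat_pow g (k - 1) *v y"
  by (simp_all add: collapse_def block_horner_diff block_horner_smult block_horner_block_vec_above
      block_horner_block_vec_0)

lemma block_horner_cyc_tensor: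
  assumes "i < k"
  shows "block_horner g (cyc_tensor k g u) i =
    mat_pow g (Suc i) *v block u (k - 1) + (if i = 0 then 0 else g *v block_horner g u (i - 1))"
  using assms
proof (induction i)
  case 0
  then show ?case using block_cyc_tensor[OF 0] by simp
next
  case (Suc i)
  then have "(Suc i + k - 1) mod k = i" by simp
  then have "block_horner g (cyc_tensor k g u) (Suc i) =
      g *v block_horner g (cyc_tensor k g u) i + g *v block u i"
    using block_cyc_tensor[OF Suc.prems] by simp
  then show ?case
    using Suc by (cases i) (simp_all add: matrix_vector_right_distrib matrix_vector_mul_assoc)
qed

lemma collapse_img:
  assumes k: "k = Suc m"
  shows "collapse k g (u - cyc_tensor k g u) = (mat 1 - mat_pow g k) *v block u m"
proof -
  have "collapse k g (u - cyc_tensor k g u) = block_horner g u m - block_horner g (cyc_tensor k g u) m"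
    unfolding collapse_def using k by (simp add: block_horner_diff)
  also have "\<dots> = (mat 1 - mat_pow g k) *v block u m"
    using block_horner_cyc_tensor[of m k g u] k
    by (cases m) (simp_all add: matrix_vector_mult_diff_rdistrib)
  finally show ?thesis .
qed

text \<open>The witness has the partial sums \<open>block_horner g v i\<close>, \<open>i < m\<close>, as blocks.\<close>

lemma collapse_congruence:
  assumes k: "k = Suc m" and v: "v \<in> zvecs (2 * k)"
  shows "v - block_vec m (collapse k g v) \<in> img_lattice k g"
proof -
  define f where "f = (\<lambda>i. if i < m then block_horner g v i else 0)"
  define u where "u = of_blocks k f"
  have u: "u \<in> zvecs (2 * k)" by (simp add: u_def of_blocks_zvecs)
  have m: "m < k" using k by simp
  have "u - cyc_tensor k g u = v - block_vec m (collapse k g v)"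
  proof (rule block_ext)
    show "u - cyc_tensor k g u \<in> zvecs (2 * k)" "v - block_vec m (collapse k g v) \<in> zvecs (2 * k)"
      using add_subgroup_diff[OF add_subgroup_zvecs u cyc_tensor_zvecs]
        add_subgroup_diff[OF add_subgroup_zvecs v block_vec_zvecs[OF m]] by simp_all
    fix i assume i: "i < k"
    have "block (u - cyc_tensor k g u) i = f i - g *v f ((i + k - 1) mod k)"
      using i by (simp add: block_cyc_tensor u_def)
    also have "\<dots> = block (v - block_vec m (collapse k g v)) i"
    proof (cases i)
      case 0
      have "(0 + k - 1) mod k = m" using k by simp
      then show ?thesis using 0 k by (cases "m = 0") (simp_all add: f_def collapse_def)
    next
      case (Suc j)
      then have "i + k - 1 = j + k" "j < k" "j < m" using i k by simp_all
      then have "f ((i + k - 1) mod k) = block_horner g v j" "j < m" by (simp_all add: f_def)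
      moreover have "block (v - block_vec m (collapse k g v)) i =
          block v (Suc j) - (if Suc j = m then block_horner g v m else 0)"
        using Suc k by (simp add: collapse_def)
      ultimately show ?thesis using Suc by (cases "Suc j = m") (auto simp: f_def)
    qed
    finally show "block (u - cyc_tensor k g u) i = block (v - block_vec m (collapse k g v)) i" .
  qed
  then show ?thesis using u unfolding img_lattice_def by (metis imageI)
qed

lemma img_lattice_iff_collapse:
  assumes k: "k = Suc m" and v: "v \<in> zvecs (2 * k)"
  shows "v \<in> img_lattice k g \<longleftrightarrow> collapse k g v \<in> col_lattice (mat 1 - mat_pow g k)"
proof
  assume "v \<in> img_lattice k g"
  then obtain u where "v = u - cyc_tensor k g u" by (auto simp: img_lattice_def)
  then show "collapse k g v \<in> col_lattice (mat 1 - mat_pow g k)"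
    using collapse_img[OF k] by (auto simp: col_lattice_def)
next
  assume "collapse k g v \<in> col_lattice (mat 1 - mat_pow g k)"
  then obtain y where y: "collapse k g v = (mat 1 - mat_pow g k) *v y"
    by (auto simp: col_lattice_def)
  define w where "w = block_vec m y - cyc_tensor k g (block_vec m y)"
  have "block_vec m y \<in> zvecs (2 * k)" using k by (intro block_vec_zvecs) simp
  then have w: "w \<in> img_lattice k g" "w \<in> zvecs (2 * k)"
    using img_lattice_subset by (auto simp: w_def img_lattice_def)
  have "collapse k g w = collapse k g v" using collapse_img[OF k] y by (simp add: w_def)
  then have "v - block_vec m (collapse k g v) - (w - block_vec m (collapse k g v)) \<in> img_lattice k g"
    using collapse_congruence[OF k] v w(2) add_subgroup_diff[OF add_subgroup_img_lattice] by metis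
  then show "v \<in> img_lattice k g"
    using add_subgroup_add[OF add_subgroup_img_lattice _ w(1)] by fastforce
qed

lemma cyc_tensor_block_vec_last:
  assumes k: "k = Suc m"
  shows "cyc_tensor k (mat 1) (block_vec m y) = block_vec 0 y"
proof (rule block_ext[OF cyc_tensor_zvecs block_vec_zvecs])
  show "0 < k" using k by simp
  fix i assume i: "i < k"
  have "(i + k - 1) mod k = m \<longleftrightarrow> i = 0"
  proof (cases i)
    case (Suc j)
    then have "i + k - 1 = j + k" "j < m" "j < k" using i k by simp_all
    then have "(i + k - 1) mod k = j" by simp
    then show ?thesis using Suc \<open>j < m\<close> by simp
  qed (use k in simp)
  then show "block (cyc_tensor k (mat 1) (block_vec m y)) i = block (block_vec 0 y) i"
    using block_cyc_tensor[OF i] by simp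
qed

lemma collapse_rotation:
  assumes k: "k = Suc m" and v: "v \<in> zvecs (2 * k)"
  shows "collapse k g (cyc_tensor k (mat 1) v) - mat_pow g m *v collapse k g v
    \<in> col_lattice (mat 1 - mat_pow g k)"
proof -
  let ?S = "cyc_tensor k (mat 1)" and ?e = "block_vec m (collapse k g v)"
  have "?S (v - ?e) \<in> img_lattice k g"
    using collapse_congruence[OF k v] quotient_action_coker[of k g] k
    by (auto simp: quotient_action_def)
  moreover have "?S (v - ?e) = ?S v - block_vec 0 (collapse k g v)"
    by (simp add: cyc_tensor_diff cyc_tensor_block_vec_last[OF k])
  moreover have "?S v - block_vec 0 (collapse k g v) \<in> zvecs (2 * k)"
    using k by (intro add_subgroup_diff[OF add_subgroup_zvecs cyc_tensor_zvecs block_vec_zvecs]) simp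
  ultimately show ?thesis
    using img_lattice_iff_collapse[OF k] k by (simp add: collapse_diff collapse_block_vec_0)
qed

lemma c_k_eq_torsion_orbit_count:
  "c_k k g = torsion_orbit_count (zvecs (2 * k)) (img_lattice k g) (\<lambda>n v p. n * v p) (cyc_tensor k (mat 1))"
proof -
  have "coker_tors k g = torsion_classes (zvecs (2 * k)) (img_lattice k g) (\<lambda>n v p. n * v p)"
    by (simp add: coker_tors_def torsion_classes_def coker_class_def quot_class_def)
  then show ?thesis
    unfolding c_k_def torsion_orbit_count_def class_orbit_def by (simp add: full_SetCompr_eq Setcompr_eq_image)
qed

theorem c_k_eq_lattice_orbit_count:
  assumes g: "det g = 1" and k: "k = Suc m"
  shows "c_k k g = lattice_orbit_count (mat 1 - mat_pow g k) (mat_pow g m)"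
proof -
  interpret quotient_action_hom "zvecs (2 * k)" "img_lattice k g" "\<lambda>n v p. n * v p"
    "cyc_tensor k (mat 1)" UNIV "col_lattice (mat 1 - mat_pow g k)" "(*s)" "\<lambda>x. mat_pow g m *v x"
    "collapse k g"
  proof
    show "quotient_action (zvecs (2 * k)) (img_lattice k g) (\<lambda>n v p. n * v p) (cyc_tensor k (mat 1))"
      using k by (intro quotient_action_coker) simp
    show "quotient_action UNIV (col_lattice (mat 1 - mat_pow g k)) (*s) (\<lambda>x. mat_pow g m *v x)"
      by (rule quotient_action_mat_pow[OF g])
    have "y = collapse k g (block_vec m y)" "block_vec m y \<in> zvecs (2 * k)" for y
      using collapse_block_vec_last[of k g y] k by (simp, intro block_vec_zvecs, simp)
    then show "collapse k g ` zvecs (2 * k) = UNIV" by blast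
  qed (simp_all add: collapse_diff collapse_smult img_lattice_iff_collapse[OF k]
      collapse_rotation[OF k])
  show ?thesis
    unfolding c_k_eq_torsion_orbit_count lattice_orbit_count_def by (rule torsion_orbit_count_eq)
qed

section \<open>Counting orbits with Burnside's lemma\<close>

primrec geom_mat :: "imat2 \<Rightarrow> nat \<Rightarrow> imat2" where
  "geom_mat M 0 = mat 0"
| "geom_mat M (Suc n) = mat 1 + M ** geom_mat M n"

lemma geom_mat_commute: "M ** geom_mat M n = geom_mat M n ** M"
  by (induction n) (simp_all add: matrix_add_ldistrib matrix_add_rdistrib matrix_mul_assoc)

lemma one_minus_mult_geom_mat: "(mat 1 - M) ** geom_mat M n = mat 1 - mat_pow M n"
proof (induction n)
  case (Suc n)
  have "(mat 1 - M) ** geom_mat M (Suc n) = (mat 1 - M) + (mat 1 - M) ** (M ** geom_mat M n)"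
    by (simp add: matrix_add_ldistrib)
  also have "(mat 1 - M) ** (M ** geom_mat M n) = M ** ((mat 1 - M) ** geom_mat M n)"
    by (simp add: matrix_mul_assoc matrix_diff_ldistrib matrix_diff_rdistrib)
  also have "\<dots> = M - mat_pow M (Suc n)" using Suc by (simp add: matrix_diff_ldistrib)
  finally show ?case by simp
qed (simp add: mat2_expand)

definition pow_fixed_mod :: "imat2 \<Rightarrow> nat \<Rightarrow> nat \<Rightarrow> (int^2) set" where
  "pow_fixed_mod g k a = {x. mat_pow g a *v x - x \<in> col_lattice (mat 1 - mat_pow g k)}"

lemma mat_pow_col_lattice:
  assumes "y \<in> col_lattice (mat 1 - mat_pow g k)"
  shows "mat_pow g a *v y \<in> col_lattice (mat 1 - mat_pow g k)"
proof -
  obtain u where "y = (mat 1 - mat_pow g k) *v u" using assms by (auto simp: col_lattice_def)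
  then have "mat_pow g a *v y = (mat 1 - mat_pow g k) *v (mat_pow g a *v u)"
    by (simp add: matrix_vector_mul_assoc one_minus_mat_pow_commute)
  then show ?thesis by (auto simp: col_lattice_def)
qed

lemma pow_fixed_mod_add:
  assumes "x \<in> pow_fixed_mod g k a" "x \<in> pow_fixed_mod g k b"
  shows "x \<in> pow_fixed_mod g k (a + b)"
proof -
  have "mat_pow g (a + b) *v x - x = mat_pow g a *v (mat_pow g b *v x - x) + (mat_pow g a *v x - x)"
    by (simp add: mat_pow_add matrix_vector_mul_assoc matrix_vector_mult_diff_distrib)
  also have "\<dots> \<in> col_lattice (mat 1 - mat_pow g k)"
    using assms by (intro add_subgroup_add[OF add_subgroup_col_lattice] mat_pow_col_lattice)
      (simp_all add: pow_fixed_mod_def)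
  finally show ?thesis by (simp add: pow_fixed_mod_def)
qed

lemma pow_fixed_mod_diff:
  assumes "x \<in> pow_fixed_mod g k (a + b)" "x \<in> pow_fixed_mod g k b"
  shows "x \<in> pow_fixed_mod g k a"
proof -
  have "mat_pow g a *v x - x = (mat_pow g (a + b) *v x - x) - mat_pow g a *v (mat_pow g b *v x - x)"
    by (simp add: mat_pow_add matrix_vector_mul_assoc matrix_vector_mult_diff_distrib)
  also have "\<dots> \<in> col_lattice (mat 1 - mat_pow g k)"
  proof (rule add_subgroup_diff[OF add_subgroup_col_lattice])
    show "mat_pow g (a + b) *v x - x \<in> col_lattice (mat 1 - mat_pow g k)"
      using assms(1) by (simp add: pow_fixed_mod_def)
    show "mat_pow g a *v (mat_pow g b *v x - x) \<in> col_lattice (mat 1 - mat_pow g k)"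
      using assms(2) by (intro mat_pow_col_lattice) (simp add: pow_fixed_mod_def)
  qed
  finally show ?thesis by (simp add: pow_fixed_mod_def)
qed

lemma pow_fixed_mod_mult: "x \<in> pow_fixed_mod g k a \<Longrightarrow> x \<in> pow_fixed_mod g k (a * c)"
proof (induction c)
  case 0
  then show ?case
    using add_subgroup_col_lattice by (simp add: pow_fixed_mod_def add_subgroup_def)
next
  case (Suc c)
  then show ?case using pow_fixed_mod_add[of x g k a "a * c"] by (simp add: add.commute)
qed

lemma pow_fixed_mod_self: "x \<in> pow_fixed_mod g k k"
proof -
  have "mat_pow g k *v x - x = (mat 1 - mat_pow g k) *v (- x)"
    by (simp add: mat2_expand algebra_simps)
  then show ?thesis by (auto simp: pow_fixed_mod_def col_lattice_def)
qed

lemma pow_fixed_mod_gcd: "pow_fixed_mod g k a = pow_fixed_mod g k (gcd a k)"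
proof (intro equalityI subsetI)
  fix x assume x: "x \<in> pow_fixed_mod g k (gcd a k)"
  obtain c where "a = gcd a k * c" by (meson gcd_dvd1 dvdE)
  then show "x \<in> pow_fixed_mod g k a" using pow_fixed_mod_mult[OF x, of c] by simp
next
  fix x assume x: "x \<in> pow_fixed_mod g k a"
  show "x \<in> pow_fixed_mod g k (gcd a k)"
  proof (cases "a = 0")
    case True
    then show ?thesis using pow_fixed_mod_self by simp
  next
    case False
    then obtain u v where uv: "a * u = k * v + gcd a k" using bezout_nat by blast
    have "x \<in> pow_fixed_mod g k (gcd a k + k * v)"
      using pow_fixed_mod_mult[OF x, of u] uv by (simp add: add.commute)
    then show ?thesis using pow_fixed_mod_diff pow_fixed_mod_mult[OF pow_fixed_mod_self] by blast
  qed
qed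

text \<open>With \<open>N = 1 + g\<^sup>d + \<dots> + g\<^sup>d\<^sup>(\<^sup>c\<^sup>-\<^sup>1\<^sup>)\<close> we have \<open>(1 - g\<^sup>d) N = 1 - g\<^sup>k\<close>, so the classes fixed
  by \<open>g\<^sup>d\<close> form \<open>N \<int>\<^sup>2 / (1 - g\<^sup>d) N \<int>\<^sup>2\<close>, a group of order \<open>|det (1 - g\<^sup>d)|\<close>.\<close>

lemma pow_fixed_mod_eq_col_lattice:
  assumes dD: "det (mat 1 - mat_pow g d) \<noteq> 0" and k: "k = d * c"
  shows "pow_fixed_mod g k d = col_lattice (geom_mat (mat_pow g d) c)"
proof -
  define D N where "D = mat 1 - mat_pow g d" and "N = geom_mat (mat_pow g d) c"
  have DN: "D ** N = mat 1 - mat_pow g k"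
    unfolding D_def N_def using one_minus_mult_geom_mat[of "mat_pow g d" c] k by (simp add: mat_pow_mult)
  show ?thesis unfolding N_def[symmetric]
  proof (intro equalityI subsetI)
    fix x assume "x \<in> pow_fixed_mod g k d"
    then obtain u where "mat_pow g d *v x - x = (D ** N) *v u"
      using DN by (auto simp: pow_fixed_mod_def col_lattice_def)
    then have "D *v (x + N *v u) = D *v 0"
      by (simp add: D_def matrix_vector_mult_diff_rdistrib matrix_vector_right_distrib
          matrix_vector_mul_assoc[symmetric] algebra_simps)
    then have "x + N *v u = 0" using matrix_vector_mult_cancel dD D_def by blast
    then have "x = N *v (- u)" by (simp add: mat2_expand algebra_simps eq_neg_iff_add_eq_0)
    then show "x \<in> col_lattice N" by (auto simp: col_lattice_def)
  next
    fix x assume "x \<in> col_lattice N"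
    then obtain u where "x = N *v u" by (auto simp: col_lattice_def)
    then have "mat_pow g d *v x - x = (D ** N) *v (- u)"
      by (simp add: D_def matrix_vector_mul_assoc[symmetric] mat2_expand algebra_simps)
    then show "x \<in> pow_fixed_mod g k d" using DN by (auto simp: pow_fixed_mod_def col_lattice_def)
  qed
qed

lemma card_pow_fixed_mod:
  assumes "d dvd k" and dD: "det (mat 1 - mat_pow g d) \<noteq> 0"
    and dA: "det (mat 1 - mat_pow g k) \<noteq> 0"
  shows "card (quot_class UNIV (col_lattice (mat 1 - mat_pow g k)) ` pow_fixed_mod g k d) =
    nat \<bar>det (mat 1 - mat_pow g d)\<bar>"
proof -
  obtain c where c: "k = d * c" using assms(1) by (auto simp: dvd_def)
  define D N where "D = mat 1 - mat_pow g d" and "N = geom_mat (mat_pow g d) c"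
  have DN: "D ** N = mat 1 - mat_pow g k"
    unfolding D_def N_def using one_minus_mult_geom_mat[of "mat_pow g d" c] c by (simp add: mat_pow_mult)
  moreover have "N ** D = D ** N"
    unfolding D_def N_def by (simp add: matrix_diff_ldistrib matrix_diff_rdistrib geom_mat_commute)
  moreover have "det N \<noteq> 0" using DN det_mul[of D N] dA by auto
  ultimately show ?thesis
    using card_quotient_col_lattice_mult[of D N] pow_fixed_mod_eq_col_lattice[OF dD c] dD
    by (simp add: D_def N_def)
qed

lemma funpow_image: "(image f ^^ n) C = (f ^^ n) ` (C :: 'a set)" for f :: "'a \<Rightarrow> 'a"
  by (induction n) (simp_all add: image_comp)

lemma funpow_mat_pow_mult: "((\<lambda>x. mat_pow g m *v x) ^^ n) x = mat_pow g (m * n) *v x"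
  by (induction n) (simp_all add: mat_pow_add matrix_vector_mul_assoc)

lemma lattice_orbit_count_burnside:
  assumes g: "det g = 1" and k: "k = Suc m" and dA: "det (mat 1 - mat_pow g k) \<noteq> 0"
  shows "k * lattice_orbit_count (mat 1 - mat_pow g k) (mat_pow g m) =
    (\<Sum>j<k. card (quot_class UNIV (col_lattice (mat 1 - mat_pow g k)) ` pow_fixed_mod g k (gcd j k)))"
proof -
  define L where "L = col_lattice (mat 1 - mat_pow g k)"
  define S where "S = (\<lambda>x. mat_pow g m *v x)"
  define X where "X = range (quot_class UNIV L)"
  have q: "quotient_action UNIV L (*s) S" unfolding L_def S_def by (rule quotient_action_mat_pow[OF g])
  have L: "add_subgroup L" unfolding L_def by (rule add_subgroup_col_lattice)
  have image_S: "(image S ^^ n) (quot_class UNIV L x) = quot_class UNIV L (mat_pow g (m * n) *v x)"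
    for n x
    using quotient_action_funpow_image_class[OF q UNIV_I]
    by (simp add: funpow_image S_def funpow_mat_pow_mult)
  have fixed: "(image S ^^ j) (quot_class UNIV L x) = quot_class UNIV L x \<longleftrightarrow> x \<in> pow_fixed_mod g k (m * j)"
    for j x
    unfolding image_S quot_class_eq_iff[OF L UNIV_I UNIV_I] by (simp add: pow_fixed_mod_def L_def)
  have "k * card ((\<lambda>C. range (\<lambda>n. (image S ^^ n) C)) ` X) =
      (\<Sum>j<k. card {C\<in>X. (image S ^^ j) C = C})"
  proof (rule card_funpow_orbits)
    show "finite X" unfolding X_def L_def by (rule finite_quotient_col_lattice[OF dA])
    show "image S ` X \<subseteq> X" using image_S[of 1] by (auto simp: X_def)
    show "(image S ^^ k) C = C" if "C \<in> X" for C
      using that fixed pow_fixed_mod_mult[OF pow_fixed_mod_self, of _ g k m]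
      by (auto simp: X_def mult.commute)
  qed (simp add: k)
  moreover have "{C\<in>X. (image S ^^ j) C = C} = quot_class UNIV L ` pow_fixed_mod g k (gcd j k)" for j
  proof -
    have "gcd (m * j) k = gcd j k" using gcd_mult_left_left_cancel[of k m j] k by simp
    then show ?thesis using pow_fixed_mod_gcd[of g k "m * j"] fixed by (auto simp: X_def)
  qed
  moreover have "lattice_orbit_count (mat 1 - mat_pow g k) (mat_pow g m) =
      card ((\<lambda>C. range (\<lambda>n. (image S ^^ n) C)) ` X)"
    unfolding lattice_orbit_count_def torsion_orbit_count_def torsion_classes_col_lattice[OF dA]
    by (simp add: class_orbit_def funpow_image S_def X_def L_def)
  ultimately show ?thesis by (simp add: L_def)
qed

lemma sum_gcd_eq_sum_totient:
  fixes h :: "nat \<Rightarrow> 'a::comm_semiring_1"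
  assumes k: "k > 0"
  shows "(\<Sum>j<k. h (gcd j k)) = (\<Sum>d | d dvd k. of_nat (totient (k div d)) * h d)"
proof -
  have "{..<k} = insert 0 {0<..<k}" "{0<..k} = insert k {0<..<k}" using k by auto
  then have "(\<Sum>j<k. h (gcd j k)) = (\<Sum>j\<in>{0<..k}. h (gcd j k))" by simp
  also have "\<dots> = (\<Sum>d\<in>(\<lambda>j. gcd j k) ` {0<..k}. \<Sum>j | j \<in> {0<..k} \<and> gcd j k = d. h (gcd j k))"
    by (rule sum.image_gen) simp
  also have "(\<lambda>j. gcd j k) ` {0<..k} = {d. d dvd k}"
  proof (intro equalityI subsetI)
    fix d assume "d \<in> {d. d dvd k}"
    then have "d \<in> {0<..k}" "d = gcd d k"
      using k dvd_imp_le[of d k] by (auto simp: gcd_nat.absorb1 intro!: Nat.gr0I)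
    then show "d \<in> (\<lambda>j. gcd j k) ` {0<..k}" by (rule rev_image_eqI)
  qed auto
  also have "(\<Sum>d | d dvd k. \<Sum>j | j \<in> {0<..k} \<and> gcd j k = d. h (gcd j k)) =
      (\<Sum>d | d dvd k. of_nat (card {j \<in> {0<..k}. gcd j k = d}) * h d)"
    by (intro sum.cong) auto
  finally show ?thesis using card_gcd_eq_totient[OF k] by simp
qed

section \<open>Traces of powers in \<open>SL\<^sub>2(\<int>)\<close>\<close>

lemma det_one_minus:
  assumes "det (M::imat2) = 1"
  shows "det (mat 1 - M) = 2 - trace M"
  using assms by (simp add: det_2 trace2 mat_def algebra_simps)

lemma cayley_hamilton_SL2:
  assumes "det (g::imat2) = 1"
  shows "g ** g = mat (trace g) ** g - mat 1"
  using assms by (simp add: mat2_expand det_2 trace2 algebra_simps)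

lemma trace_mat_smult: "trace (mat c ** (A::imat2)) = c * trace A"
  by (simp add: trace2 mat2_expand algebra_simps)

lemma trace_mat_pow_Suc_Suc:
  assumes g: "det g = 1"
  shows "trace (mat_pow g (Suc (Suc n))) = trace g * trace (mat_pow g (Suc n)) - trace (mat_pow g n)"
proof -
  have "mat_pow g (Suc (Suc n)) = mat_pow g n ** (g ** g)"
    using mat_pow_add[of g n 2] by (simp add: numeral_2_eq_2)
  also have "\<dots> = mat (trace g) ** (mat_pow g n ** g) - mat_pow g n"
    unfolding cayley_hamilton_SL2[OF g]
    by (simp add: matrix_diff_ldistrib matrix_mul_assoc matrix_mult_mat_commute)
  finally have "mat_pow g (Suc (Suc n)) = mat (trace g) ** mat_pow g (Suc n) - mat_pow g n"
    by (simp only: mat_pow_Suc_right)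
  then show ?thesis by (simp only: trace_sub trace_mat_smult)
qed

lemma trace_mat_1: "trace (mat 1 :: imat2) = 2"
  by (simp add: trace2 mat_def)

text \<open>Hyperbolic case: by the recursion \<open>t\<^sub>n\<^sub>+\<^sub>2 = t t\<^sub>n\<^sub>+\<^sub>1 - t\<^sub>n\<close>, \<open>|tr g\<^sup>n|\<close> grows strictly when \<open>|tr g| \<ge> 3\<close>.\<close>

lemma abs_trace_mat_pow_less:
  assumes g: "det g = 1" and t: "\<bar>trace g\<bar> \<ge> 3"
  shows "\<bar>trace (mat_pow g n)\<bar> < \<bar>trace (mat_pow g (Suc n))\<bar>"
proof (induction n)
  case 0
  then show ?case using t by (simp add: trace_mat_1)
next
  case (Suc n)
  let ?a = "trace (mat_pow g n)" and ?b = "trace (mat_pow g (Suc n))"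
  have "3 * \<bar>?b\<bar> \<le> \<bar>trace g\<bar> * \<bar>?b\<bar>" using t by (simp add: mult_right_mono)
  moreover have "\<bar>trace g * ?b\<bar> - \<bar>?a\<bar> \<le> \<bar>trace g * ?b - ?a\<bar>" by linarith
  ultimately have "\<bar>trace (mat_pow g (Suc (Suc n)))\<bar> \<ge> 3 * \<bar>?b\<bar> - \<bar>?a\<bar>"
    using trace_mat_pow_Suc_Suc[OF g, of n] by (simp add: abs_mult)
  then show ?case using Suc by linarith
qed

lemma abs_trace_mat_pow_gt_2:
  assumes g: "det g = 1" and t: "\<bar>trace g\<bar> \<ge> 3" and n: "n \<ge> 1"
  shows "\<bar>trace (mat_pow g n)\<bar> > 2"
proof -
  have ge: "\<bar>trace (mat_pow g j)\<bar> \<ge> 2" for j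
  proof (induction j)
    case (Suc j)
    then show ?case using abs_trace_mat_pow_less[OF g t, of j] by linarith
  qed (simp add: trace_mat_1)
  obtain j where "n = Suc j" using n by (cases n) auto
  moreover have "\<bar>trace (mat_pow g (Suc j))\<bar> > 2" using abs_trace_mat_pow_less[OF g t, of j] ge[of j] by linarith
  ultimately show ?thesis by simp
qed

lemma mat_pow_mat2_2:
  "mat_pow (mat2 a b c d) 2 =
    mat2 ((a+d)*a - (a*d - b*c)) ((a+d)*b) ((a+d)*c) ((a+d)*d - (a*d - b*c))"
  by (simp add: numeral_2_eq_2 mat2_expand algebra_simps)

lemma mat_pow_mat2_3:
  "mat_pow (mat2 a b c d) 3 =
    mat2 (((a+d)*(a+d) - (a*d - b*c))*a - (a+d)*(a*d - b*c)) (((a+d)*(a+d) - (a*d - b*c))*b)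
      (((a+d)*(a+d) - (a*d - b*c))*c) (((a+d)*(a+d) - (a*d - b*c))*d - (a+d)*(a*d - b*c))"
  by (simp add: numeral_3_eq_3 mat2_expand algebra_simps)

text \<open>Elliptic case: \<open>g\<^sup>2 = -1\<close> for trace \<open>0\<close> and \<open>g\<^sup>3 = \<mp>1\<close> for trace \<open>\<plusminus>1\<close>.\<close>

lemma mat_pow_12_elliptic:
  assumes g: "det g = 1" and t: "\<bar>trace g\<bar> \<le> 1"
  shows "mat_pow g 12 = mat 1"
proof -
  define a b c d where "a = g$1$1" and "b = g$1$2" and "c = g$2$1" and "d = g$2$2"
  have abcd: "g = mat2 a b c d" "a * d - b * c = 1"
    using g mat2_eta[of g] by (simp_all add: a_def b_def c_def d_def det_2)
  have t': "a + d \<in> {-1, 0, 1}" using t abcd(1) by (auto simp: trace2)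
  have neg_sq: "mat (-1) ** mat (-1) = (mat 1 :: imat2)" by (simp add: mat2_expand)
  consider "mat_pow g 2 = mat (-1)" | "mat_pow g 3 = mat (-1)" | "mat_pow g 3 = mat 1"
    using t' abcd by (auto simp: mat_pow_mat2_2 mat_pow_mat2_3 mat2_expand)
  then show ?thesis
  proof cases
    case 1
    then have "mat_pow g 4 = mat 1" using mat_pow_add[of g 2 2] neg_sq by simp
    then have "mat_pow (mat_pow g 4) 3 = mat 1" by simp
    then show ?thesis by (simp add: mat_pow_mult)
  next
    case 2
    then have "mat_pow g 6 = mat 1" using mat_pow_add[of g 3 3] neg_sq by simp
    then have "mat_pow (mat_pow g 6) 2 = mat 1" by simp
    then show ?thesis by (simp add: mat_pow_mult)
  next
    case 3
    then have "mat_pow (mat_pow g 3) 4 = mat 1" by simp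
    then show ?thesis by (simp add: mat_pow_mult)
  qed
qed

text \<open>Parabolic case: \<open>g - 1\<close> is nilpotent, so \<open>g\<^sup>n = 1 + n (g - 1)\<close>.\<close>

lemma mat_pow_trace_2:
  assumes g: "det g = 1" and t: "trace g = 2"
  shows "mat_pow g n = mat 1 + mat (int n) ** (g - mat 1)"
proof (induction n)
  case (Suc n)
  have "mat 2 ** g = g + g" by (simp add: mat2_expand)
  then have "g ** (g - mat 1) = (g + g - mat 1) - g"
    using cayley_hamilton_SL2[OF g] t by (simp add: matrix_diff_ldistrib)
  then have "g ** (g - mat 1) = g - mat 1" by (simp add: algebra_simps)
  moreover have "g ** (mat (int n) ** (g - mat 1)) = mat (int n) ** (g ** (g - mat 1))"
    by (simp only: matrix_mul_assoc matrix_mult_mat_commute)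
  ultimately have "g ** (mat (int n) ** (g - mat 1)) = mat (int n) ** (g - mat 1)" by simp
  then show ?case
    using Suc by (simp add: matrix_add_ldistrib matrix_add_rdistrib mat_add algebra_simps)
qed simp

lemma trace_2_finite_order:
  assumes d: "det g = 1" and t: "trace g = 2" and n: "n > 0" and p: "mat_pow g n = mat 1"
  shows "g = mat 1"
proof -
  have "mat (int n) ** (g - mat 1) = 0" using mat_pow_trace_2[OF d t, of n] p by simp
  then show ?thesis using n by (simp add: mat2_expand)
qed

lemma mat_pow_eq_1_if_trace_2:
  assumes g: "det g = 1" and t: "trace g \<noteq> 2" "trace g \<noteq> -2" and d: "d \<ge> 1"
    and td: "trace (mat_pow g d) = 2"
  shows "mat_pow g d = mat 1"
proof (cases "\<bar>trace g\<bar> \<ge> 3")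
  case True
  then show ?thesis using abs_trace_mat_pow_gt_2[OF g True d] td by simp
next
  case False
  then have "mat_pow g 12 = mat 1" using t mat_pow_12_elliptic[OF g] by simp
  moreover have "mat_pow (mat_pow g d) 12 = mat_pow (mat_pow g 12) d"
    by (simp only: mat_pow_mult mult.commute)
  ultimately have "mat_pow (mat_pow g d) 12 = mat 1" by simp
  then show ?thesis using trace_2_finite_order[OF det_mat_pow[OF g] td, of 12] by simp
qed

lemma det_one_minus_mat_pow_nonzero:
  assumes g: "det g = 1" and t: "trace g \<noteq> 2" "trace g \<noteq> -2" and gk: "mat_pow g k \<noteq> mat 1"
    and "d dvd k" "k > 0"
  shows "det (mat 1 - mat_pow g d) \<noteq> 0"
proof
  assume "det (mat 1 - mat_pow g d) = 0"
  then have "trace (mat_pow g d) = 2" using det_one_minus[OF det_mat_pow[OF g]] by simp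
  moreover have "d \<ge> 1" using \<open>d dvd k\<close> \<open>k > 0\<close> by (cases "d = 0") auto
  ultimately have "mat_pow g d = mat 1" using mat_pow_eq_1_if_trace_2[OF g t] by blast
  moreover obtain c where "k = d * c" using \<open>d dvd k\<close> by (auto simp: dvd_def)
  ultimately show False using gk by (simp add: mat_pow_mult[symmetric])
qed

section \<open>The four cases\<close>

theorem c_k_totient_formula:
  assumes g: "det g = 1" and "k \<ge> 1" and t: "trace g \<noteq> 2" "trace g \<noteq> -2"
    and gk: "mat_pow g k \<noteq> mat 1"
  shows "real (c_k k g) =
    1 / real k * (\<Sum>d | d dvd k. real (totient (k div d)) * \<bar>real_of_int (trace (mat_pow g d)) - 2\<bar>)"
proof -
  obtain m where k: "k = Suc m" using \<open>k \<ge> 1\<close> by (cases k) auto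
  have nonsingular: "det (mat 1 - mat_pow g d) \<noteq> 0" if "d dvd k" for d
    using det_one_minus_mat_pow_nonzero[OF g t gk that] k by simp
  define h where "h d = nat \<bar>det (mat 1 - mat_pow g d)\<bar>" for d
  have "k * c_k k g =
      (\<Sum>j<k. card (quot_class UNIV (col_lattice (mat 1 - mat_pow g k)) ` pow_fixed_mod g k (gcd j k)))"
    using lattice_orbit_count_burnside[OF g k nonsingular] c_k_eq_lattice_orbit_count[OF g k] by simp
  also have "\<dots> = (\<Sum>j<k. h (gcd j k))"
    using card_pow_fixed_mod[OF _ nonsingular nonsingular] by (simp add: h_def)
  also have "\<dots> = (\<Sum>d | d dvd k. totient (k div d) * h d)"
    using sum_gcd_eq_sum_totient[of k h] \<open>k \<ge> 1\<close> by simp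
  finally have "real (k * c_k k g) = real (\<Sum>d | d dvd k. totient (k div d) * h d)"
    by (rule arg_cong)
  then have "real k * real (c_k k g) = (\<Sum>d | d dvd k. real (totient (k div d)) * real (h d))"
    by (simp only: of_nat_mult of_nat_sum)
  moreover have "real (h d) = \<bar>real_of_int (trace (mat_pow g d)) - 2\<bar>" for d
    using det_one_minus[OF det_mat_pow[OF g, of d]] by (simp add: h_def)
  ultimately show ?thesis using k by (simp add: field_simps)
qed

theorem c_k_finite_order:
  assumes g: "det g = 1" and "k \<ge> 1" and gk: "mat_pow g k = mat 1"
  shows "c_k k g = 1"
proof -
  obtain m where k: "k = Suc m" using \<open>k \<ge> 1\<close> by (cases k) auto
  have "col_lattice (mat 1 - mat_pow g k) = {0}" by (auto simp: gk col_lattice_def)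
  moreover have "torsion_classes UNIV {0::int^2} (*s) = {quot_class UNIV {0} 0}"
  proof (intro equalityI subsetI)
    fix C assume "C \<in> torsion_classes UNIV {0::int^2} (*s)"
    then obtain v and n :: int where "C = quot_class UNIV {0} v" "n > 0" "n *s v = 0"
      by (auto simp: torsion_classes_def)
    moreover from this have "v = 0" by (simp add: vec_eq_iff)
    ultimately show "C \<in> {quot_class UNIV {0} 0}" by simp
  qed (auto simp: torsion_classes_def intro!: exI[of _ "0::int^2"] exI[of _ "1::int"])
  ultimately show ?thesis
    by (simp add: c_k_eq_lattice_orbit_count[OF g k] lattice_orbit_count_def torsion_orbit_count_def)
qed

lemma c_k_conj:
  assumes "conj_SL2Z g h" and h: "det h = 1" and k: "k = Suc m"
  shows "c_k k g = lattice_orbit_count (mat 1 - mat_pow h k) (mat_pow h m)"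
proof -
  obtain P Q where P: "det P = 1" and PQ: "P ** Q = mat 1" and g: "g = P ** h ** Q"
    using assms(1) by (auto simp: conj_SL2Z_def SL2Z_def)
  have QP: "Q ** P = mat 1" using right_inverse_imp_left_inverse[OF P PQ] .
  have "det g = 1" using g h PQ det_mul[of P Q] by (simp add: det_mul)
  moreover have "mat 1 - mat_pow g k = P ** (mat 1 - mat_pow h k) ** Q"
    using mat_pow_conj[OF PQ QP] PQ g by (simp add: matrix_diff_ldistrib matrix_diff_rdistrib)
  ultimately have "c_k k g = lattice_orbit_count (P ** (mat 1 - mat_pow h k) ** Q) (P ** mat_pow h m ** Q)"
    using c_k_eq_lattice_orbit_count[OF _ k] mat_pow_conj[OF PQ QP] g by simp
  also have "\<dots> = lattice_orbit_count (mat 1 - mat_pow h k) (mat_pow h m)"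
    using invertible_det_1[OF det_mat_pow[OF h]]
    by (intro lattice_orbit_count_conj[OF _ _ _ PQ QP] one_minus_mat_pow_commute)
  finally show ?thesis .
qed

subsection \<open>Parabolic elements\<close>

lemma T_pow_eq_mat2: "T_pow a = mat2 1 a 0 1"
  by (simp add: T_pow_def vec_eq_iff forall_2)

lemma T_pow_add: "T_pow a ** T_pow b = T_pow (a + b)"
  by (simp add: T_pow_eq_mat2 mat2_expand)

lemma T_pow_0: "T_pow 0 = mat 1"
  by (simp add: T_pow_eq_mat2 mat2_expand)

lemma T_pow_fix: "v$2 = 0 \<Longrightarrow> T_pow b *v v = v"
  and neg_T_pow_fix: "v$2 = 0 \<Longrightarrow> (- T_pow b) *v v = - v"
  by (simp_all add: T_pow_eq_mat2 mat2_expand)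

lemma det_T_pow: "det (T_pow a) = 1" and det_neg_T_pow: "det (- T_pow a) = 1"
  by (simp_all add: T_pow_eq_mat2 det_2)

lemma mat_pow_T_pow: "mat_pow (T_pow a) n = T_pow (a * int n)"
  by (induction n) (simp_all add: T_pow_add algebra_simps, simp add: T_pow_eq_mat2 mat2_expand)

lemma mat_pow_neg_T_pow:
  "mat_pow (- T_pow a) n = (if even n then T_pow (a * int n) else - T_pow (a * int n))"
  by (induction n) (simp_all add: T_pow_eq_mat2 mat2_expand algebra_simps)

lemma col_lattice_one_minus_T_pow:
  "v \<in> col_lattice (mat 1 - T_pow c) \<longleftrightarrow> v$2 = 0 \<and> c dvd v$1"
proof
  assume "v \<in> col_lattice (mat 1 - T_pow c)"
  then obtain u where "v = (mat 1 - T_pow c) *v u" by (auto simp: col_lattice_def)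
  then have "v$1 = c * (- u$2)" "v$2 = 0" by (simp_all add: T_pow_eq_mat2 mat2_expand)
  then show "v$2 = 0 \<and> c dvd v$1" by simp
next
  assume v: "v$2 = 0 \<and> c dvd v$1"
  then obtain q where "v$1 = c * q" by (auto simp: dvd_def)
  then have "v = (mat 1 - T_pow c) *v vec2 0 (- q)" using v by (simp add: T_pow_eq_mat2 mat2_expand)
  then show "v \<in> col_lattice (mat 1 - T_pow c)" by (auto simp: col_lattice_def)
qed

lemma torsion_classes_one_minus_T_pow:
  assumes c: "c \<noteq> 0"
  shows "torsion_classes UNIV (col_lattice (mat 1 - T_pow c)) (*s) =
    quot_class UNIV (col_lattice (mat 1 - T_pow c)) ` {v. v$2 = 0}"
proof (intro equalityI subsetI)
  fix C assume "C \<in> torsion_classes UNIV (col_lattice (mat 1 - T_pow c)) (*s)"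
  then obtain v and n :: int where v: "C = quot_class UNIV (col_lattice (mat 1 - T_pow c)) v"
    "n > 0" "n *s v \<in> col_lattice (mat 1 - T_pow c)"
    by (auto simp: torsion_classes_def)
  then show "C \<in> quot_class UNIV (col_lattice (mat 1 - T_pow c)) ` {v. v$2 = 0}"
    by (simp add: col_lattice_one_minus_T_pow)
next
  fix C assume "C \<in> quot_class UNIV (col_lattice (mat 1 - T_pow c)) ` {v. v$2 = 0}"
  then obtain v where v: "C = quot_class UNIV (col_lattice (mat 1 - T_pow c)) v" "v$2 = 0" by auto
  then have "\<bar>c\<bar> *s v \<in> col_lattice (mat 1 - T_pow c)" by (simp add: col_lattice_one_minus_T_pow)
  then show "C \<in> torsion_classes UNIV (col_lattice (mat 1 - T_pow c)) (*s)"
    using v(1) c unfolding torsion_classes_def by force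
qed

lemma card_torsion_one_minus_T_pow:
  assumes c: "c \<noteq> 0"
  shows "card (quot_class UNIV (col_lattice (mat 1 - T_pow c)) ` {v. v$2 = 0}) = nat \<bar>c\<bar>"
proof -
  define R where "R = (\<lambda>r. vec2 r 0) ` {0..<\<bar>c\<bar>}"
  have "card R = nat \<bar>c\<bar>" unfolding R_def by (subst card_image) (auto simp: inj_on_def)
  moreover have "card (quot_class UNIV (col_lattice (mat 1 - T_pow c)) ` {v. v$2 = 0}) = card R"
  proof (rule card_quot_class_image_transversal[OF add_subgroup_col_lattice])
    show "R \<subseteq> {v. v$2 = 0}" by (auto simp: R_def)
  next
    fix y :: "int^2" assume "y \<in> {v. v$2 = 0}"
    moreover have "c dvd y$1 - y$1 mod \<bar>c\<bar>" by (simp add: minus_mod_eq_mult_div)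
    ultimately have "y - vec2 (y$1 mod \<bar>c\<bar>) 0 \<in> col_lattice (mat 1 - T_pow c)"
      by (simp add: col_lattice_one_minus_T_pow)
    moreover have "vec2 (y$1 mod \<bar>c\<bar>) 0 \<in> R" using c by (simp add: R_def)
    ultimately show "\<exists>r\<in>R. y - r \<in> col_lattice (mat 1 - T_pow c)" by blast
  next
    fix r r' assume "r \<in> R" "r' \<in> R" "r - r' \<in> col_lattice (mat 1 - T_pow c)"
    then obtain x x' where x: "r = vec2 x 0" "r' = vec2 x' 0" "0 \<le> x" "x < \<bar>c\<bar>" "0 \<le> x'" "x' < \<bar>c\<bar>"
      and "c dvd x - x'"
      by (auto simp: R_def col_lattice_one_minus_T_pow)
    then have "x - x' = 0" using dvd_imp_le_int[of "x - x'" c] by fastforce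
    then show "r = r'" using x by simp
  qed
  ultimately show ?thesis by simp
qed

lemma quotient_action_T_pow:
  "quotient_action UNIV (col_lattice (mat 1 - T_pow c)) (*s) (\<lambda>x. T_pow b *v x)"
  by (rule quotient_action_col_lattice[where B' = "T_pow (- b)"])
    (simp_all add: T_pow_add matrix_diff_ldistrib matrix_diff_rdistrib add.commute T_pow_0)

lemma quotient_action_neg_T_pow:
  "quotient_action UNIV (col_lattice (mat 1 - T_pow c)) (*s) (\<lambda>x. (- T_pow b) *v x)"
  by (rule quotient_action_col_lattice[where B' = "- T_pow (- b)"])
    (simp_all add: T_pow_eq_mat2 mat2_expand algebra_simps)

lemma image_class_T_pow:
  assumes "v$2 = 0"
  shows "(\<lambda>x. T_pow b *v x) ` quot_class UNIV (col_lattice (mat 1 - T_pow c)) v =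
      quot_class UNIV (col_lattice (mat 1 - T_pow c)) v"
    and "(\<lambda>x. (- T_pow b) *v x) ` quot_class UNIV (col_lattice (mat 1 - T_pow c)) v =
      quot_class UNIV (col_lattice (mat 1 - T_pow c)) (- v)"
  using quotient_action_image_class[OF quotient_action_T_pow[where b = b and c = c] UNIV_I, of v]
    quotient_action_image_class[OF quotient_action_neg_T_pow[where b = b and c = c] UNIV_I, of v]
    T_pow_fix[OF assms] neg_T_pow_fix[OF assms]
  by simp_all

lemma lattice_orbit_count_T_pow:
  assumes a: "a \<noteq> 0" and k: "k = Suc m"
  shows "lattice_orbit_count (mat 1 - mat_pow (T_pow a) k) (mat_pow (T_pow a) m) = nat \<bar>a\<bar> * k"
proof -
  define c where "c = a * int k"
  have c: "c \<noteq> 0" using a k by (simp add: c_def)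
  let ?L = "col_lattice (mat 1 - T_pow c)"
  have "torsion_orbit_count UNIV ?L (*s) (\<lambda>x. T_pow (a * int m) *v x) =
      card (torsion_classes UNIV ?L (*s))"
  proof (rule torsion_orbit_count_trivial_action)
    fix C assume "C \<in> torsion_classes UNIV ?L (*s)"
    then obtain v where "C = quot_class UNIV ?L v" "v$2 = 0"
      using torsion_classes_one_minus_T_pow[OF c] by auto
    then show "(\<lambda>x. T_pow (a * int m) *v x) ` C = C" using image_class_T_pow(1) by simp
  qed
  also have "\<dots> = nat \<bar>a\<bar> * k"
    using torsion_classes_one_minus_T_pow[OF c] card_torsion_one_minus_T_pow[OF c]
    by (simp add: c_def abs_mult nat_mult_distrib)
  finally show ?thesis by (simp add: lattice_orbit_count_def mat_pow_T_pow c_def)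
qed

lemma lattice_orbit_count_neg_T_pow_odd:
  assumes k: "k = Suc m" and "odd k"
  shows "lattice_orbit_count (mat 1 - mat_pow (- T_pow a) k) (mat_pow (- T_pow a) m) = 4"
proof -
  obtain h where h: "m = 2 * h" using k \<open>odd k\<close> by (auto elim: evenE)
  define A B where "A = mat 1 + T_pow (a * int k)" and "B = T_pow (a * int m)"
  have AB: "mat 1 - mat_pow (- T_pow a) k = A" "mat_pow (- T_pow a) m = B"
    using \<open>odd k\<close> h by (simp_all add: mat_pow_neg_T_pow A_def B_def)
  have dA: "det A = 4" by (simp add: A_def T_pow_eq_mat2 mat2_expand det_2)
  have fixed: "(\<lambda>x. B *v x) ` C = C" if C: "C \<in> torsion_classes UNIV (col_lattice A) (*s)" for C
  proof -
    obtain v where v: "C = quot_class UNIV (col_lattice A) v"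
      using C torsion_classes_col_lattice[of A] dA by auto
    have "B *v v - v = A *v vec2 (a * int h * v$2) 0"
      using h by (simp add: A_def B_def T_pow_eq_mat2 mat2_expand algebra_simps)
    then have "quot_class UNIV (col_lattice A) (B *v v) = quot_class UNIV (col_lattice A) v"
      using quot_class_eq_iff[OF add_subgroup_col_lattice UNIV_I UNIV_I] by (auto simp: col_lattice_def)
    moreover have q: "quotient_action UNIV (col_lattice A) (*s) (\<lambda>x. B *v x)"
      by (rule quotient_action_col_lattice[where B' = "T_pow (- (a * int m))"])
        (simp_all add: A_def B_def T_pow_eq_mat2 mat2_expand algebra_simps)
    ultimately show ?thesis using quotient_action_image_class[OF q UNIV_I, of v] v by simp
  qed
  have "torsion_orbit_count UNIV (col_lattice A) (*s) (\<lambda>x. B *v x) =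
      card (torsion_classes UNIV (col_lattice A) (*s))"
    by (rule torsion_orbit_count_trivial_action[OF fixed])
  also have "\<dots> = 4" using torsion_classes_col_lattice[of A] card_quotient_col_lattice[of A] dA by simp
  finally show ?thesis by (simp add: AB lattice_orbit_count_def)
qed

lemma card_torsion_fixed_by_neg:
  assumes c: "c \<noteq> 0" and "even c"
  shows "card (quot_class UNIV (col_lattice (mat 1 - T_pow c)) ` {v. v$2 = 0 \<and> c dvd 2 * v$1}) = 2"
proof -
  have "even \<bar>c\<bar>" using \<open>even c\<close> by simp
  then obtain h where h: "\<bar>c\<bar> = 2 * h" by (rule evenE)
  have h0: "h > 0" using h c by simp
  have abs_dvd: "c dvd x \<longleftrightarrow> 2 * h dvd x" for x unfolding h[symmetric] by simp
  let ?L = "col_lattice (mat 1 - T_pow c)"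
  have "card {vec2 0 0, vec2 h 0} = 2" using h0 by (simp add: card_insert_if)
  moreover have "card (quot_class UNIV ?L ` {v. v$2 = 0 \<and> c dvd 2 * v$1}) = card {vec2 0 0, vec2 h 0}"
  proof (rule card_quot_class_image_transversal[OF add_subgroup_col_lattice])
    show "{vec2 0 0, vec2 h 0} \<subseteq> {v. v$2 = 0 \<and> c dvd 2 * v$1}" by (simp add: abs_dvd)
  next
    fix y :: "int^2" assume y: "y \<in> {v. v$2 = 0 \<and> c dvd 2 * v$1}"
    then have "2 * h dvd 2 * y$1" by (simp add: abs_dvd)
    then obtain q where q: "y$1 = h * q" using h0 by (auto simp: dvd_def)
    have "c dvd y$1 \<or> c dvd y$1 - h"
    proof (cases "even q")
      case True
      then obtain q' where "q = 2 * q'" by (rule evenE)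
      then show ?thesis using q by (simp add: abs_dvd)
    next
      case False
      then obtain q' where "q = 2 * q' + 1" by (rule oddE)
      then have "y$1 - h = 2 * h * q'" using q by (simp add: algebra_simps)
      then show ?thesis by (simp add: abs_dvd)
    qed
    then show "\<exists>r\<in>{vec2 0 0, vec2 h 0}. y - r \<in> ?L" using y by (auto simp: col_lattice_one_minus_T_pow)
  next
    fix r r' assume rr: "r \<in> {vec2 0 0, vec2 h 0}" "r' \<in> {vec2 0 0, vec2 h 0}" "r - r' \<in> ?L"
    have "\<not> c dvd h"
    proof
      assume "c dvd h"
      then have "\<bar>c\<bar> \<le> h" using dvd_imp_le_int[of h c] h0 by simp
      then show False using h h0 by simp
    qed
    then show "r = r'" using rr by (auto simp: col_lattice_one_minus_T_pow)
  qed
  ultimately show ?thesis by simp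
qed

text \<open>For \<open>k\<close> even, \<open>g\<^sup>k\<^sup>-\<^sup>1\<close> acts on the torsion \<open>\<int>/mk\<close> by negation, whose orbits are the
  \<open>|mk|/2 - 1\<close> pairs \<open>{x, -x}\<close> and the two fixed points \<open>0\<close> and \<open>mk/2\<close>.\<close>

lemma lattice_orbit_count_neg_T_pow_even:
  assumes a: "a \<noteq> 0" and k: "k = Suc m" and "even k"
  shows "2 * lattice_orbit_count (mat 1 - mat_pow (- T_pow a) k) (mat_pow (- T_pow a) m) = nat \<bar>a\<bar> * k + 2"
proof -
  define c where "c = a * int k"
  have c: "c \<noteq> 0" "even c" using a k \<open>even k\<close> by (simp_all add: c_def)
  define L where "L = col_lattice (mat 1 - T_pow c)"
  define S where "S = (\<lambda>x. (- T_pow (a * int m)) *v x)"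
  define X where "X = quot_class UNIV L ` {v. v$2 = 0}"
  have "odd m" using k \<open>even k\<close> by simp
  then have AB: "mat 1 - mat_pow (- T_pow a) k = mat 1 - T_pow c"
    "mat_pow (- T_pow a) m = - T_pow (a * int m)"
    using \<open>even k\<close> by (simp_all only: mat_pow_neg_T_pow c_def if_True if_False)
  have negate: "image S (quot_class UNIV L v) = quot_class UNIV L (- v)" if "v$2 = 0" for v
    using image_class_T_pow(2)[OF that] by (simp add: S_def L_def)
  have fixed_iff: "quot_class UNIV L (- v) = quot_class UNIV L v \<longleftrightarrow> c dvd 2 * v$1" if "v$2 = 0" for v
    using that quot_class_eq_iff[OF add_subgroup_col_lattice UNIV_I UNIV_I]
    by (simp add: L_def col_lattice_one_minus_T_pow flip: mult_2)
  have cX: "card X = nat \<bar>c\<bar>" using card_torsion_one_minus_T_pow[OF c(1)] by (simp add: X_def L_def)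
  have "2 * card ((\<lambda>C. range (\<lambda>n. (image S ^^ n) C)) ` X) = card X + card {C\<in>X. image S C = C}"
  proof (rule card_involution_orbits)
    show "finite X" using cX c card.infinite by force
    show "image S ` X \<subseteq> X" using negate by (auto simp: X_def)
    show "image S (image S C) = C" if C: "C \<in> X" for C
    proof -
      obtain v where "C = quot_class UNIV L v" "v$2 = 0" using C by (auto simp: X_def)
      then show ?thesis using negate[of v] negate[of "- v"] by simp
    qed
  qed
  also have "{C\<in>X. image S C = C} = quot_class UNIV L ` {v. v$2 = 0 \<and> c dvd 2 * v$1}"
  proof (intro equalityI subsetI)
    fix C assume "C \<in> {C\<in>X. image S C = C}"
    then obtain v where "C = quot_class UNIV L v" "v$2 = 0" "quot_class UNIV L (- v) = quot_class UNIV L v"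
      using negate by (auto simp: X_def)
    then show "C \<in> quot_class UNIV L ` {v. v$2 = 0 \<and> c dvd 2 * v$1}" using fixed_iff by auto
  next
    fix C assume "C \<in> quot_class UNIV L ` {v. v$2 = 0 \<and> c dvd 2 * v$1}"
    then obtain v where "C = quot_class UNIV L v" "v$2 = 0" "c dvd 2 * v$1" by auto
    then show "C \<in> {C\<in>X. image S C = C}" by (simp add: X_def negate fixed_iff)
  qed
  finally have orbits: "2 * card ((\<lambda>C. range (\<lambda>n. (image S ^^ n) C)) ` X) = nat \<bar>c\<bar> + 2"
    using cX card_torsion_fixed_by_neg[OF c] by (simp add: L_def)
  have "lattice_orbit_count (mat 1 - mat_pow (- T_pow a) k) (mat_pow (- T_pow a) m) =
      card ((\<lambda>C. range (\<lambda>n. (image S ^^ n) C)) ` X)"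
    unfolding AB lattice_orbit_count_def torsion_orbit_count_def
      torsion_classes_one_minus_T_pow[OF c(1)]
    by (simp add: class_orbit_def funpow_image S_def X_def L_def)
  moreover have "nat \<bar>c\<bar> = nat \<bar>a\<bar> * k" by (simp add: c_def abs_mult nat_mult_distrib)
  ultimately show ?thesis using orbits by (simp only:)
qed

theorem c_k_conj_T_pow:
  assumes "k \<ge> 1" and "m \<noteq> 0" and "conj_SL2Z g (T_pow m)"
  shows "c_k k g = nat \<bar>m\<bar> * k"
proof -
  obtain n where k: "k = Suc n" using assms(1) by (cases k) auto
  show ?thesis
    using c_k_conj[OF assms(3) det_T_pow k] lattice_orbit_count_T_pow[OF assms(2) k] by simp
qed

theorem c_k_conj_neg_T_pow_even:
  assumes "k \<ge> 1" and "m \<noteq> 0" and "conj_SL2Z g (- T_pow m)" and "even k"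
  shows "real (c_k k g) = real_of_int \<bar>m\<bar> * real k / 2 + 1"
proof -
  obtain n where k: "k = Suc n" using assms(1) by (cases k) auto
  have "2 * c_k k g = nat \<bar>m\<bar> * k + 2"
    using c_k_conj[OF assms(3) det_neg_T_pow k] lattice_orbit_count_neg_T_pow_even[OF assms(2) k assms(4)]
    by simp
  then have "real (2 * c_k k g) = real (nat \<bar>m\<bar> * k + 2)" by (rule arg_cong)
  then show ?thesis by simp
qed

theorem c_k_conj_neg_T_pow_odd:
  assumes "conj_SL2Z g (- T_pow m)" and "odd k"
  shows "c_k k g = 4"
proof -
  obtain n where k: "k = Suc n" using \<open>odd k\<close> by (cases k) auto
  show ?thesis
    using c_k_conj[OF assms(1) det_neg_T_pow k] lattice_orbit_count_neg_T_pow_odd[OF k assms(2)] by simp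
qed

theorem theorem3p5:
  fixes g :: imat2 and k :: nat
  assumes "g \<in> SL2Z" and "k \<ge> 1"
  shows "(trace g \<noteq> 2 \<and> trace g \<noteq> -2 \<and> mat_pow g k \<noteq> mat 1 \<longrightarrow>
           real (c_k k g) = (1 / real k) *
             (\<Sum>d\<in>{d. d dvd k}. real (totient (k div d)) * \<bar>real_of_int (trace (mat_pow g d)) - 2\<bar>))
       \<and> (mat_pow g k = mat 1 \<longrightarrow> c_k k g = 1)
       \<and> (\<forall>m::int. m \<noteq> 0 \<and> conj_SL2Z g (T_pow m) \<longrightarrow> c_k k g = nat \<bar>m\<bar> * k)
       \<and> (\<forall>m::int. m \<noteq> 0 \<and> conj_SL2Z g (- T_pow m) \<and> even k \<longrightarrow>
            real (c_k k g) = real_of_int \<bar>m\<bar> * real k / 2 + 1)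
       \<and> (\<forall>m::int. conj_SL2Z g (- T_pow m) \<and> odd k \<longrightarrow> c_k k g = 4)"
proof -
  have g: "det g = 1" using assms(1) by (simp add: SL2Z_def)
  show ?thesis
    by (intro conjI allI impI; (elim conjE)?)
      (rule c_k_totient_formula[OF g assms(2)] c_k_finite_order[OF g assms(2)]
        c_k_conj_T_pow[OF assms(2)] c_k_conj_neg_T_pow_even[OF assms(2)]
        c_k_conj_neg_T_pow_odd; assumption)+
qed

end
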